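(* Let $d>2$ and let $\mathbf{K}$ be a convex body in $\mathbb{E}^d$ whose boundary contains a partial flag of length $d-2$, i.e., there are faces $F_2\subset F_3\subset\cdots\subset F_{d-1}$ of $\mathbf{K}$ with $\dim F_i=i$ for $i=2,\dots,d-1$. Then $I_c(\mathbf{K})=d+1$. In particular, for any convex polytope $\mathbf{P}$ in $\mathbb{E}^d$, $d>2$, we have $I_c(\mathbf{P})=d+1$.
   Context: $\mathbb{E}^d$ is $d$-dimensional Euclidean space with unit sphere $\mathbb{S}^{d-1}$. A convex body in $\mathbb{E}^d$ is a compact convex set with nonempty interior; a convex polytope in $\mathbb{E}^d$ is a convex body that is the convex hull of finitely many points. A face $F$ of a convex body $\mathbf{K}\subset\mathbb{E}^d$ is a convex subset of $\mathbf{K}$ such that any segment contained in $\mathbf{K}$ whose relative interior intersects $F$ is contained in $F$. A partial flag of length $d-s$ is a sequence of faces $F_s\subset\cdots\subset F_{d-1}$ of $\mathbf{K}$ with $\dim F_i=i$ for $i=s,\dots,d-1$. A boundary point $\mathbf{p}\in\operatorname{bd}\mathbf{K}$ is illuminated from the direction $\mathbf{v}\in\mathbb{S}^{d-1}$ if the half-line with endpoint $\mathbf{p}$ and direction $\mathbf{v}$ intersects $\operatorname{int}\mathbf{K}$. Directions $\mathbf{v}_1,\dots,\mathbf{v}_m\in\mathbb{S}^{d-1}$ illuminate $\mathbf{K}$ if every boundary point of $\mathbf{K}$ is illuminated from some $\mathbf{v}_i$. Convex bodies $\mathbf{K},\mathbf{K}'\subset\mathbb{E}^d$ are combinatorially equivalent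 if there is a homeomorphism $h:\operatorname{bd}\mathbf{K}\to\operatorname{bd}\mathbf{K}'$ such that for any $X\subset\operatorname{bd}\mathbf{K}$, $X$ is a face of $\mathbf{K}$ if and only if $h(X)$ is a face of $\mathbf{K}'$. The equivalence classes are called combinatorial classes. The combinatorial illumination number $I_c(\mathbf{K})$ is the smallest number $k$ such that some element of the combinatorial class of $\mathbf{K}$ can be illuminated from $k$ directions. *)

theory Defs
  imports "HOL-Analysis.Analysis"
begin

definition convex_body :: "'a::euclidean_space set \<Rightarrow> bool" where
  "convex_body K \<longleftrightarrow> compact K \<and> convex K \<and> interior K \<noteq> {}"

definition convex_polytope :: "'a::euclidean_space set \<Rightarrow> bool" where
  "convex_polytope P \<longleftrightarrow> convex_body P \<and> polytope P"

text \<open>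
  The faces of the flag are indexed by their dimension; only the values
  \<open>F i\<close> with \<open>s \<le> i < DIM('a)\<close> matter. Strictness of the
  inclusions follows from the dimensions.
\<close>

definition partial_flag :: "'a::euclidean_space set \<Rightarrow> nat \<Rightarrow> (nat \<Rightarrow> 'a set) \<Rightarrow> bool" where
  "partial_flag K s F \<longleftrightarrow>
     (\<forall>i\<in>{s..<DIM('a)}. F i face_of K \<and> aff_dim (F i) = int i) \<and>
     (\<forall>i. s \<le> i \<and> Suc i < DIM('a) \<longrightarrow> F i \<subseteq> F (Suc i))"

definition illuminated_from :: "'a::euclidean_space set \<Rightarrow> 'a \<Rightarrow> 'a \<Rightarrow> bool" where
  "illuminated_from K p v \<longleftrightarrow> (\<exists>t\<ge>0. p + t *\<^sub>R v \<in> interior K)"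

definition illuminate :: "(nat \<Rightarrow> 'a::euclidean_space) \<Rightarrow> nat \<Rightarrow> 'a set \<Rightarrow> bool" where
  "illuminate v m K \<longleftrightarrow>
     (\<forall>i<m. v i \<in> sphere 0 1) \<and> (\<forall>p\<in>frontier K. \<exists>i<m. illuminated_from K p (v i))"

definition combinatorially_equivalent ::
  "'a::euclidean_space set \<Rightarrow> 'a set \<Rightarrow> bool" where
  "combinatorially_equivalent K K' \<longleftrightarrow>
     convex_body K \<and> convex_body K' \<and>
     (\<exists>h g. homeomorphism (frontier K) (frontier K') h g \<and>
            (\<forall>X\<subseteq>frontier K. X face_of K \<longleftrightarrow> h ` X face_of K'))"

definition combinatorial_illumination_number :: "'a::euclidean_space set \<Rightarrow> nat" where
  "combinatorial_illumination_number K =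
     (LEAST k. \<exists>K' v. combinatorially_equivalent K K' \<and> illuminate v k K')"

end

theory Submission
  imports Defs
begin

text \<open>
  Fewer than \<open>d + 1\<close> directions never illuminate a body: some nonzero linear form is nonnegative on
  all of them, and a point where it attains its maximum over the body is not illuminated.

  Conversely, projective maps that are regular on \<open>K\<close> preserve its combinatorial class. If a facet \<open>F\<close>
  of \<open>K\<close> has a projective image illuminated by \<open>k\<close> directions, then \<open>K\<close> has one illuminated by
  \<open>k + 1\<close>: move the hyperplane that is sent to infinity towards \<open>F\<close>, so that the image of \<open>K\<close>
  approaches a pyramid over \<open>F\<close>. Small perturbations of the old directions illuminate a neighbourhood
  of \<open>F\<close>, and the direction from the apex to the base illuminates the rest of the boundary. Climbing up
  the flag reduces the theorem to the plane. There a body with an edge is again handled by the facet step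
  applied to the edge, and a strictly convex body is illuminated by the edge directions of an
  inscribed triangle of maximal area.
\<close>

section \<open>Facets\<close>

text \<open>Tube lemma with a filter \<open>G\<close> in the second factor: finitely many of the
  product neighbourhoods cover \<open>C\<close>, and finitely many conditions on \<open>y\<close>
  hold together. It turns choices made at single points of a compact set into one choice of
  parameters.\<close>

lemma compact_eventually_uniform:
  assumes "compact C" and "\<And>q. q \<in> C \<Longrightarrow> eventually P (nhds q \<times>\<^sub>F G)"
  obtains U where "open U" "C \<subseteq> U" "\<forall>\<^sub>F y in G. \<forall>x\<in>U. P (x, y)"
proof -
  have "\<exists>V Q. open V \<and> q \<in> V \<and> eventually Q G \<and> (\<forall>x\<in>V. \<forall>y. Q y \<longrightarrow> P (x, y))" if "q \<in> C" for q
  proof -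
    obtain Pf Pg where *: "eventually Pf (nhds q)" "eventually Pg G"
      "\<And>x y. Pf x \<Longrightarrow> Pg y \<Longrightarrow> P (x, y)"
      using assms(2)[OF \<open>q \<in> C\<close>] unfolding eventually_prod_filter by blast
    then obtain V where "open V" "q \<in> V" "\<forall>x\<in>V. Pf x"
      unfolding eventually_nhds by blast
    with * show ?thesis by blast
  qed
  then obtain V Q where VQ: "\<And>q. q \<in> C \<Longrightarrow> open (V q)" "\<And>q. q \<in> C \<Longrightarrow> q \<in> V q"
    "\<And>q. q \<in> C \<Longrightarrow> eventually (Q q) G"
    "\<And>q x y. q \<in> C \<Longrightarrow> x \<in> V q \<Longrightarrow> Q q y \<Longrightarrow> P (x, y)"
    by metis
  obtain D where D: "D \<subseteq> C" "finite D" "C \<subseteq> (\<Union>q\<in>D. V q)"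
    using compactE_image[OF assms(1), of C V] VQ(1,2) by blast
  show thesis
  proof
    show "open (\<Union>q\<in>D. V q)" using D VQ(1) by blast
    show "C \<subseteq> (\<Union>q\<in>D. V q)" by (rule D)
    have "\<forall>\<^sub>F y in G. \<forall>q\<in>D. Q q y"
      using D VQ(3) by (intro eventually_ball_finite) auto
    then show "\<forall>\<^sub>F y in G. \<forall>x\<in>\<Union>q\<in>D. V q. P (x, y)"
      by eventually_elim (use D VQ(4) in blast)
  qed
qed

text \<open>The relative interior is open in the affine hull. Membership in the hull stays a premise
  because it is checked by separate algebra at each use.\<close>

lemma eventually_in_rel_interior:
  assumes "(f \<longlongrightarrow> r) G" "r \<in> rel_interior S"
  shows "\<forall>\<^sub>F x in G. f x \<in> affine hull S \<longrightarrow> f x \<in> rel_interior S"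
proof -
  obtain T where T: "open T" "rel_interior S = affine hull S \<inter> T"
    using openin_rel_interior[of S] unfolding openin_open by blast
  then have "\<forall>\<^sub>F x in G. f x \<in> T"
    using assms topological_tendstoD by blast
  then show ?thesis by eventually_elim (use T in auto)
qed

text \<open>Split \<open>w - s *\<^sub>R p\<close> as
  \<open>(w - s *\<^sub>R f) + s *\<^sub>R (f - p)\<close> with \<open>f\<close> in
  \<open>A\<close>. Both summands are directions of \<open>B\<close>, the first because it joins two
  points of \<open>A\<close>.\<close>

lemma affine_field_mono:
  fixes w :: "'a::real_vector"
  assumes "affine B" "A \<subseteq> B" "A \<noteq> {}" "\<And>p. p \<in> A \<Longrightarrow> p + (w - s *\<^sub>R p) \<in> A" "p \<in> B"
  shows "p + t *\<^sub>R (w - s *\<^sub>R p) \<in> B"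
proof -
  obtain f where f: "f \<in> A" using assms by blast
  have "(p + t *\<^sub>R ((f + (w - s *\<^sub>R f)) - f)) + (t * s) *\<^sub>R (f - p) \<in> B"
    using assms f by (intro mem_affine_3_minus) auto
  also have "(p + t *\<^sub>R ((f + (w - s *\<^sub>R f)) - f)) + (t * s) *\<^sub>R (f - p) = p + t *\<^sub>R (w - s *\<^sub>R p)"
    by (simp add: algebra_simps)
  finally show ?thesis .
qed

lemma supporting_face:
  fixes K :: "'a::euclidean_space set"
  assumes "convex K" "x \<in> K" "x \<notin> rel_interior K"
  obtains h where "\<And>z. z \<in> K \<Longrightarrow> h \<bullet> x \<le> h \<bullet> z"
    "(K \<inter> {z. h \<bullet> z = h \<bullet> x}) face_of K" "K \<inter> {z. h \<bullet> z = h \<bullet> x} \<noteq> K"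
proof -
  obtain h where h: "\<And>z. z \<in> K \<Longrightarrow> h \<bullet> x \<le> h \<bullet> z" "\<And>z. z \<in> rel_interior K \<Longrightarrow> h \<bullet> x < h \<bullet> z"
    using supporting_hyperplane_rel_boundary[OF assms] by metis
  have "rel_interior K \<noteq> {}" using assms rel_interior_eq_empty by blast
  then obtain r where "r \<in> rel_interior K" by blast
  then have "r \<in> K" "h \<bullet> x < h \<bullet> r" using h rel_interior_subset by blast+
  then have "K \<inter> {z. h \<bullet> z = h \<bullet> x} \<noteq> K" by force
  moreover have "(K \<inter> {z. h \<bullet> z = h \<bullet> x}) face_of K"
    using h(1) assms(1) by (intro face_of_Int_supporting_hyperplane_ge) auto
  ultimately show thesis using that h(1) by blast
qed

text \<open>\<open>G\<close> contains \<open>F\<close> because it meets the relative interior of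
  \<open>F\<close>; a proper face of \<open>K\<close> cannot have larger dimension than the facet
  \<open>F\<close>, so the two agree.\<close>

lemma face_eq_facet:
  fixes K :: "'a::euclidean_space set"
  assumes "convex K" "F face_of K" "aff_dim K = aff_dim F + 1"
    and "G face_of K" "G \<noteq> K" "b \<in> G" "b \<in> rel_interior F"
  shows "G = F"
proof (rule ccontr)
  assume "G \<noteq> F"
  have "F \<subseteq> G"
    using assms by (intro subset_of_face_of[OF assms(4)]) (auto dest: face_of_imp_subset)
  then have "F face_of G"
    using assms face_of_subset face_of_imp_subset by blast
  then have "aff_dim F < aff_dim G"
    using \<open>G \<noteq> F\<close> assms face_of_aff_dim_lt face_of_imp_convex by metis
  moreover have "aff_dim G < aff_dim K"
    using assms face_of_aff_dim_lt by blast
  ultimately show False using assms by linarith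
qed

text \<open>Otherwise a supporting face at the midpoint contains \<open>q\<close> and
  \<open>b\<close>, hence equals \<open>F\<close> by \<open>face_eq_facet\<close>, against
  \<open>q \<notin> F\<close>.\<close>

lemma midpoint_facet_in_rel_interior:
  fixes K :: "'a::euclidean_space set"
  assumes "convex K" "F face_of K" "aff_dim K = aff_dim F + 1"
    and "q \<in> K" "q \<notin> F" "b \<in> rel_interior F"
  shows "midpoint q b \<in> rel_interior K"
proof (rule ccontr)
  assume out: "midpoint q b \<notin> rel_interior K"
  have b: "b \<in> F" "b \<in> K"
    using assms rel_interior_subset face_of_imp_subset by blast+
  have "q \<noteq> b" using assms b by blast
  have "midpoint q b \<in> K"
    using assms(1,4) b by (meson closed_segment_subset midpoint_in_closed_segment subsetD)
  then obtain h where h: "(K \<inter> {z. h \<bullet> z = h \<bullet> midpoint q b}) face_of K"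
    "K \<inter> {z. h \<bullet> z = h \<bullet> midpoint q b} \<noteq> K"
    using supporting_face[OF assms(1) _ out] by metis
  let ?G = "K \<inter> {z. h \<bullet> z = h \<bullet> midpoint q b}"
  have "midpoint q b \<in> open_segment q b" using \<open>q \<noteq> b\<close> by simp
  then have "q \<in> ?G" "b \<in> ?G"
    using face_ofD[OF h(1), of "midpoint q b" q b] assms b \<open>midpoint q b \<in> K\<close> by blast+
  then show False
    using face_eq_facet[OF assms(1-3) h] assms by blast
qed

text \<open>Facets are exposed: a supporting hyperplane at a relative interior point of
  \<open>F\<close> cuts out a proper face through that point, which can only be
  \<open>F\<close>.\<close>

lemma facet_functional:
  fixes K :: "'a::euclidean_space set"
  assumes "convex K" "F face_of K" "aff_dim K = aff_dim F + 1" "F \<noteq> {}"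
  obtains h c where "\<And>z. z \<in> K \<Longrightarrow> c \<le> h \<bullet> z" "F = K \<inter> {z. h \<bullet> z = c}"
proof -
  have "F \<noteq> K" using assms(3) by auto
  obtain b where b: "b \<in> rel_interior F"
    using assms rel_interior_eq_empty face_of_imp_convex by blast
  then have "b \<in> K" "b \<in> F"
    using assms rel_interior_subset face_of_imp_subset by blast+
  then have "b \<notin> rel_interior K"
    using face_of_disjoint_rel_interior[OF assms(2) \<open>F \<noteq> K\<close>] by blast
  then obtain h where h: "\<And>z. z \<in> K \<Longrightarrow> h \<bullet> b \<le> h \<bullet> z"
    "(K \<inter> {z. h \<bullet> z = h \<bullet> b}) face_of K" "K \<inter> {z. h \<bullet> z = h \<bullet> b} \<noteq> K"
    using supporting_face[OF assms(1) \<open>b \<in> K\<close>] by metis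
  then show thesis
    using that face_eq_facet[OF assms(1-3) h(2,3) _ b] \<open>b \<in> K\<close> by blast
qed

lemma affine_hull_facet:
  fixes K :: "'a::euclidean_space set"
  assumes "F = K \<inter> {z. h \<bullet> z = c}" "aff_dim K = aff_dim F + 1" "F \<noteq> {}"
  shows "affine hull F = affine hull K \<inter> {z. h \<bullet> z = c}"
proof (rule affine_dim_equal)
  let ?A = "affine hull K \<inter> {z. h \<bullet> z = c}"
  show aff: "affine ?A" by (intro affine_Int affine_affine_hull affine_hyperplane)
  show sub: "affine hull F \<subseteq> ?A"
    using assms(1) hull_subset[of K affine] aff by (intro hull_minimal) auto
  show "affine hull F \<noteq> {}" using assms by simp
  have "\<not> affine hull K \<subseteq> {z. h \<bullet> z = c}"
  proof
    assume "affine hull K \<subseteq> {z. h \<bullet> z = c}"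
    then have "F = K" using assms(1) hull_subset[of K affine] by blast
    then show False using assms by simp
  qed
  moreover have "?A \<noteq> {}" using assms sub by (metis affine_hull_eq_empty subset_empty)
  ultimately have "aff_dim ?A = aff_dim K - 1"
    using aff_dim_affine_Int_hyperplane[of "affine hull K" h c] by simp
  then show "aff_dim (affine hull F) = aff_dim ?A" using assms by simp
qed simp

text \<open>Project a point strictly above the facet, near \<open>r\<close>, from a point
  \<open>a\<close> of \<open>rel_interior K\<close> onto the hyperplane of \<open>F\<close>. The
  projection is near \<open>r\<close>, hence in \<open>F\<close>, and the given point lies strictly
  between it and \<open>a\<close>.\<close>

lemma eventually_above_facet:
  fixes K :: "'a::euclidean_space set"
  assumes "convex K" "F = K \<inter> {z. h \<bullet> z = c}" "aff_dim K = aff_dim F + 1"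
    and "r \<in> rel_interior F" "\<And>z. z \<in> K \<Longrightarrow> c \<le> h \<bullet> z" "(f \<longlongrightarrow> r) G"
  shows "\<forall>\<^sub>F x in G. f x \<in> affine hull K \<and> c < h \<bullet> f x \<longrightarrow> f x \<in> rel_interior K"
proof -
  have rF: "r \<in> F" using assms rel_interior_subset by blast
  then have F_ne: "F \<noteq> {}" by blast
  obtain a where a: "a \<in> rel_interior K"
    using rF assms rel_interior_eq_empty[of K] by blast
  then have aK: "a \<in> K" using rel_interior_subset by blast
  have hr: "h \<bullet> r = c" using rF assms by blast
  have "F face_of K"
    using assms(1,2,5) face_of_Int_supporting_hyperplane_ge by blast
  moreover have "F \<noteq> K" using assms(3) by auto
  ultimately have "a \<notin> F"
    using a face_of_disjoint_rel_interior by blast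
  then have ya: "h \<bullet> a - c > 0" using assms(2,5) aK by force
  \<comment> \<open>\<open>l z\<close> is the height over the hyperplane, scaled so that
    \<open>l a = 1\<close>; \<open>g z\<close> is the point where the line through \<open>a\<close>
    and \<open>z\<close> meets the hyperplane.\<close>
  define l where "l z = (h \<bullet> z - c) / (h \<bullet> a - c)" for z
  define g where "g z = (1 / (1 - l z)) *\<^sub>R (z - l z *\<^sub>R a)" for z
  have l_lim: "((\<lambda>x. l (f x)) \<longlongrightarrow> 0) G"
  proof -
    have "((\<lambda>x. l (f x)) \<longlongrightarrow> (h \<bullet> r - c) / (h \<bullet> a - c)) G"
      unfolding l_def using ya by (intro tendsto_intros assms) auto
    then show ?thesis by (simp add: hr)
  qed
  have "((\<lambda>x. g (f x)) \<longlongrightarrow> (1 / (1 - 0)) *\<^sub>R (r - 0 *\<^sub>R a)) G"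
    unfolding g_def by (intro tendsto_intros l_lim assms) auto
  then have g_lim: "((\<lambda>x. g (f x)) \<longlongrightarrow> r) G" by simp
  have ev1: "\<forall>\<^sub>F x in G. g (f x) \<in> affine hull F \<longrightarrow> g (f x) \<in> rel_interior F"
    by (rule eventually_in_rel_interior[OF g_lim assms(4)])
  have ev2: "\<forall>\<^sub>F x in G. l (f x) < 1"
    using order_tendstoD(2)[OF l_lim, of 1] by simp
  from ev1 ev2 show ?thesis
  proof eventually_elim
    case (elim x)
    show ?case
    proof
      assume x: "f x \<in> affine hull K \<and> c < h \<bullet> f x"
      have l0: "0 < l (f x)" using x ya by (simp add: l_def)
      have comb: "f x = (1 - l (f x)) *\<^sub>R g (f x) + l (f x) *\<^sub>R a"
        using elim by (simp add: g_def)
      have "g (f x) = f x + (l (f x) / (1 - l (f x))) *\<^sub>R (f x - a)"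
      proof -
        have "f x + (l (f x) / (1 - l (f x))) *\<^sub>R (f x - a) =
          (1 + l (f x) / (1 - l (f x))) *\<^sub>R f x - (l (f x) / (1 - l (f x))) *\<^sub>R a"
          by (simp add: algebra_simps)
        also have "1 + l (f x) / (1 - l (f x)) = 1 / (1 - l (f x))"
          using elim by (simp add: field_simps)
        finally show ?thesis
          unfolding g_def by (simp add: scaleR_right_diff_distrib)
      qed
      also have "\<dots> \<in> affine hull K"
        using x hull_inc[OF aK, of affine] by (intro mem_affine_3_minus affine_affine_hull) auto
      finally have gK: "g (f x) \<in> affine hull K" .
      have "h \<bullet> f x - c = (1 - l (f x)) * (h \<bullet> g (f x) - c) + l (f x) * (h \<bullet> a - c)"
        by (subst (1) comb) (simp add: inner_simps algebra_simps)
      moreover have "l (f x) * (h \<bullet> a - c) = h \<bullet> f x - c"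
        using ya by (simp add: l_def)
      ultimately have "h \<bullet> g (f x) = c" using elim by simp
      then have "g (f x) \<in> affine hull F"
        using gK affine_hull_facet[OF assms(2,3) F_ne] by blast
      then have gF: "g (f x) \<in> rel_interior F" using elim by blast
      then have "g (f x) \<in> F" using rel_interior_subset by blast
      then have "g (f x) \<in> K" "g (f x) \<noteq> a" using assms(2) \<open>a \<notin> F\<close> by blast+
      moreover have "f x \<in> open_segment a (g (f x))"
        unfolding in_segment using elim l0 \<open>g (f x) \<noteq> a\<close> comb
        by (intro conjI exI[of _ "1 - l (f x)"]) (auto simp: add.commute)
      ultimately show "f x \<in> rel_interior K"
        using rel_interior_closure_convex_segment[OF assms(1) a, of "g (f x)"] closure_subset by blast
    qed
  qed
qed

section \<open>From a facet to the whole body\<close>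

text \<open>
  A pair \<open>(w, s)\<close> in the kernel of the linear form \<open>(x, r) \<mapsto> a \<bullet> x + c * r\<close> is a direction in the
  chart \<open>x \<mapsto> x / (a \<bullet> x + c)\<close> of projective space; back in the original chart, moving in this
  direction from \<open>p\<close> is moving along \<open>w - s *\<^sub>R p\<close>.
\<close>

definition proj_illuminable :: "'a::euclidean_space set \<Rightarrow> nat \<Rightarrow> bool" where
  "proj_illuminable K k \<longleftrightarrow>
     (\<exists>a c w s.
        (\<forall>x\<in>K. 0 < a \<bullet> x + c) \<and>
        (\<forall>i<k. a \<bullet> w i + c * s i = 0) \<and>
        (\<forall>i<k. \<forall>p\<in>affine hull K. p + (w i - s i *\<^sub>R p) \<in> affine hull K) \<and>
        (\<forall>p\<in>rel_frontier K. \<exists>i<k. \<exists>t>0.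
           t * s i < 1 \<and> p + t *\<^sub>R (w i - s i *\<^sub>R p) \<in> rel_interior K))"

text \<open>The relative frontier is empty, so the zero direction serves. Counting one direction
  starts the pattern "dimension plus one" and meets the condition \<open>0 < k\<close> of the facet
  step.\<close>

lemma proj_illuminable_sing: "proj_illuminable {x::'a::euclidean_space} 1"
  unfolding proj_illuminable_def
  by (intro exI[of _ 0] exI[of _ 1] exI[of _ "\<lambda>_. 0"]) (auto simp: rel_frontier_sing)

text \<open>The new linear form is \<open>\<epsilon>\<close> times the old one plus the height
  \<open>h \<bullet> x - d\<close> over \<open>F\<close>. The new pair is a perturbation of
  \<open>(b, 1)\<close>, whose field points towards the point \<open>b\<close> of \<open>F\<close>.
  Subtracting a small multiple of the new pair from the old pairs lifts their paths off the facet
  into the relative interior of \<open>K\<close>.\<close>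

lemma proj_illuminable_facet:
  fixes K :: "'a::euclidean_space set"
  assumes K: "compact K" "convex K" and F: "F face_of K" "aff_dim K = aff_dim F + 1" "F \<noteq> {}"
    and "proj_illuminable F k" "0 < k"
  shows "proj_illuminable K (Suc k)"
proof -
  obtain \<alpha> c w s where pos: "\<And>x. x \<in> F \<Longrightarrow> 0 < \<alpha> \<bullet> x + c"
    and ker: "\<And>i. i < k \<Longrightarrow> \<alpha> \<bullet> w i + c * s i = 0"
    and tang: "\<And>i p. i < k \<Longrightarrow> p \<in> affine hull F \<Longrightarrow> p + (w i - s i *\<^sub>R p) \<in> affine hull F"
    and illum: "\<And>p. p \<in> rel_frontier F \<Longrightarrow> \<exists>i<k. \<exists>t>0.
           t * s i < 1 \<and> p + t *\<^sub>R (w i - s i *\<^sub>R p) \<in> rel_interior F"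
    using assms(6) unfolding proj_illuminable_def by blast
  obtain h d where hK: "\<And>z. z \<in> K \<Longrightarrow> d \<le> h \<bullet> z" and Fh: "F = K \<inter> {z. h \<bullet> z = d}"
    using facet_functional[OF K(2) F] by metis
  have affF: "affine hull F = affine hull K \<inter> {z. h \<bullet> z = d}"
    by (rule affine_hull_facet[OF Fh F(2,3)])
  have cF: "compact F" "convex F" "F \<subseteq> K"
    using K F face_of_imp_compact face_of_imp_convex face_of_imp_subset by blast+
  obtain b where b: "b \<in> rel_interior F"
    using cF F(3) rel_interior_eq_empty by blast
  then have bF: "b \<in> F" using rel_interior_subset by blast
  then have bK: "b \<in> K" and hb: "h \<bullet> b = d" using Fh by blast+
  obtain a where a: "a \<in> rel_interior K"
    using K bK rel_interior_eq_empty by blast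
  then have aK: "a \<in> K" using rel_interior_subset by blast
  have "F \<noteq> K" using F(2) by auto
  then have "a \<notin> F"
    using a F face_of_disjoint_rel_interior by blast
  then have ha: "d < h \<bullet> a" using hK[OF aK] Fh aK by force
  have rfK: "rel_frontier K = K - rel_interior K" "rel_frontier F = F - rel_interior F"
    using K cF by (auto simp: rel_frontier_def compact_imp_closed)

  \<comment> \<open>The old directions and their perturbations\<close>
  have kerh: "h \<bullet> w i = d * s i" if "i < k" for i
  proof -
    \<comment> \<open>Tangency to \<open>affine hull F\<close> puts the old pairs in the kernel of
      \<open>(x, r) \<mapsto> h \<bullet> x - d * r\<close>, hence in the kernel of every
      combination of this form with the old one.\<close>
    have "b + (w i - s i *\<^sub>R b) \<in> affine hull F"
      using that bF by (intro tang hull_inc)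
    then have "h \<bullet> (b + (w i - s i *\<^sub>R b)) = d" using affF by blast
    then show ?thesis by (simp add: inner_simps hb)
  qed

  \<comment> \<open>The point reached from \<open>p\<close> at time \<open>t\<close> when the pair
    \<open>(w i, s i)\<close> is changed by adding \<open>\<zeta>\<close> times
    \<open>(a, 1)\<close> and subtracting \<open>\<eta>\<close> times \<open>(b, 1)\<close>.\<close>
  define z where "z i t \<eta> \<zeta> p =
    p + t *\<^sub>R ((w i + \<zeta> *\<^sub>R a - \<eta> *\<^sub>R b) - (s i + \<zeta> - \<eta>) *\<^sub>R p)" for i t \<eta> \<zeta> and p :: 'a
  have z_aff: "z i t \<eta> \<zeta> p \<in> affine hull K" if "i < k" "p \<in> affine hull K" for i t \<eta> \<zeta> p
  proof -
    have "p + t *\<^sub>R (w i - s i *\<^sub>R p) \<in> affine hull K"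
      using that tang F(3) affF
      by (intro affine_field_mono[of "affine hull K" "affine hull F"]) auto
    moreover have "p' + (t * \<zeta>) *\<^sub>R (a - p) + (t * \<eta>) *\<^sub>R (p - b) \<in> affine hull K"
      if "p' \<in> affine hull K" for p'
      using that \<open>p \<in> affine hull K\<close> hull_inc[OF aK, of affine] hull_inc[OF bK, of affine]
      by (intro mem_affine_3_minus affine_affine_hull) auto
    ultimately have "p + t *\<^sub>R (w i - s i *\<^sub>R p) + (t * \<zeta>) *\<^sub>R (a - p) + (t * \<eta>) *\<^sub>R (p - b)
        \<in> affine hull K" by blast
    then show ?thesis by (simp add: z_def algebra_simps)
  qed
  \<comment> \<open>For \<open>p\<close> in \<open>K\<close> and
    \<open>t * (s i + \<zeta> - \<eta>) < 1\<close> the first summand is nonnegative; the push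
    towards \<open>a\<close> makes the second one positive, so the path ends strictly above the
    facet.\<close>
  have z_height: "h \<bullet> z i t \<eta> \<zeta> p - d =
      (1 - t * (s i + \<zeta> - \<eta>)) * (h \<bullet> p - d) + t * \<zeta> * (h \<bullet> a - d)" if "i < k" for i t \<eta> \<zeta> p
    by (simp add: z_def inner_simps kerh[OF that] hb algebra_simps)

  \<comment> \<open>Points near the facet\<close>
  have F_illum: "\<exists>i<k. \<exists>t>0. t * s i < 1 \<and> q + t *\<^sub>R (w i - s i *\<^sub>R q) \<in> rel_interior F" if "q \<in> F" for q
  proof (cases "q \<in> rel_interior F")
    case False
    then show ?thesis using illum that rfK by blast
  next
    case True
    \<comment> \<open>Relative interior points of \<open>F\<close> are frontier points of
      \<open>K\<close> as well. A short step in any one direction keeps them in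
      \<open>rel_interior F\<close>; direction 0 is available because \<open>0 < k\<close>.\<close>
    let ?f = "\<lambda>t. q + t *\<^sub>R (w 0 - s 0 *\<^sub>R q)"
    have "(?f \<longlongrightarrow> q + 0 *\<^sub>R (w 0 - s 0 *\<^sub>R q)) (at_right 0)"
      by (intro tendsto_intros)
    then have "\<forall>\<^sub>F t in at_right 0. ?f t \<in> affine hull F \<longrightarrow> ?f t \<in> rel_interior F"
      by (intro eventually_in_rel_interior[OF _ True]) simp
    moreover have "((\<lambda>t. t * s 0) \<longlongrightarrow> 0 * s 0) (at_right 0)"
      by (intro tendsto_intros)
    then have "\<forall>\<^sub>F t in at_right 0. t * s 0 < 1"
      by (rule order_tendstoD) simp
    moreover have "\<forall>\<^sub>F t in at_right (0::real). 0 < t"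
      by (rule eventually_at_right_less)
    ultimately have "\<forall>\<^sub>F t in at_right 0. 0 < t \<and> t * s 0 < 1 \<and>
        (?f t \<in> affine hull F \<longrightarrow> ?f t \<in> rel_interior F)"
      by eventually_elim blast
    then obtain t where t: "0 < t" "t * s 0 < 1" "?f t \<in> affine hull F \<longrightarrow> ?f t \<in> rel_interior F"
      using eventually_happens'[OF trivial_limit_at_right_real] by blast
    have "?f t \<in> affine hull F"
      using that tang[OF \<open>0 < k\<close>] F(3)
      by (intro affine_field_mono[of "affine hull F" "affine hull F"]) (auto intro: hull_inc)
    then show ?thesis using t \<open>0 < k\<close> by blast
  qed

  \<comment> \<open>Here \<open>x\<close> is the triple of the point and the arguments
    \<open>\<eta>\<close>, \<open>\<zeta>\<close> of \<open>z\<close>. With \<open>i\<close> and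
    \<open>t\<close> fixed, the end point tends to a relative interior point of \<open>F\<close>, so
    being above the facet suffices.\<close>
  have near_F: "\<forall>\<^sub>F x in nhds q \<times>\<^sub>F nhds (0, 0).
      fst x \<in> K \<and> 0 < snd (snd x) \<longrightarrow>
      (\<exists>i<k. \<exists>t>0. t * (s i + snd (snd x) - fst (snd x)) < 1 \<and>
         z i t (fst (snd x)) (snd (snd x)) (fst x) \<in> rel_interior K)" if "q \<in> F" for q
  proof -
    obtain i t where it: "i < k" "t > 0" "t * s i < 1" "q + t *\<^sub>R (w i - s i *\<^sub>R q) \<in> rel_interior F"
      using F_illum[OF \<open>q \<in> F\<close>] by blast
    let ?G = "nhds q \<times>\<^sub>F nhds (0::real, 0::real)"
    have G: "?G = nhds (q, 0, 0)" by (simp add: nhds_prod)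
    have id: "((\<lambda>x. x) \<longlongrightarrow> (q, 0, 0)) ?G"
      unfolding G by (rule filterlim_ident)
    have lim: "(fst \<longlongrightarrow> q) ?G" "((\<lambda>x. fst (snd x)) \<longlongrightarrow> 0) ?G" "((\<lambda>x. snd (snd x)) \<longlongrightarrow> 0) ?G"
      using tendsto_fst[OF id] tendsto_fst[OF tendsto_snd[OF id]] tendsto_snd[OF tendsto_snd[OF id]]
      by simp_all
    have "((\<lambda>x. z i t (fst (snd x)) (snd (snd x)) (fst x)) \<longlongrightarrow>
        q + t *\<^sub>R ((w i + 0 *\<^sub>R a - 0 *\<^sub>R b) - (s i + 0 - 0) *\<^sub>R q)) ?G"
      unfolding z_def by (intro tendsto_intros lim)
    then have zlim: "((\<lambda>x. z i t (fst (snd x)) (snd (snd x)) (fst x)) \<longlongrightarrow>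
        q + t *\<^sub>R (w i - s i *\<^sub>R q)) ?G" by simp
    have ev1: "\<forall>\<^sub>F x in ?G. z i t (fst (snd x)) (snd (snd x)) (fst x) \<in> affine hull K \<and>
        d < h \<bullet> z i t (fst (snd x)) (snd (snd x)) (fst x) \<longrightarrow>
        z i t (fst (snd x)) (snd (snd x)) (fst x) \<in> rel_interior K"
      by (rule eventually_above_facet[OF K(2) Fh F(2) it(4) hK zlim])
    have "((\<lambda>x. t * (s i + snd (snd x) - fst (snd x))) \<longlongrightarrow> t * (s i + 0 - 0)) ?G"
      by (intro tendsto_intros lim)
    then have ev2: "\<forall>\<^sub>F x in ?G. t * (s i + snd (snd x) - fst (snd x)) < 1"
      by (rule order_tendstoD) (use it in simp)
    from ev1 ev2 show ?thesis
    proof eventually_elim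
      case (elim x)
      show ?case
      proof
        assume x: "fst x \<in> K \<and> 0 < snd (snd x)"
        have "0 \<le> (1 - t * (s i + snd (snd x) - fst (snd x))) * (h \<bullet> fst x - d)"
          using elim x hK by (intro mult_nonneg_nonneg) auto
        moreover have "0 < t * snd (snd x) * (h \<bullet> a - d)" using x it ha by simp
        ultimately have "d < h \<bullet> z i t (fst (snd x)) (snd (snd x)) (fst x)"
          using z_height[OF it(1), of t "fst (snd x)" "snd (snd x)" "fst x"] by linarith
        moreover have "z i t (fst (snd x)) (snd (snd x)) (fst x) \<in> affine hull K"
          using x by (intro z_aff it hull_inc) auto
        ultimately show "\<exists>i<k. \<exists>t>0. t * (s i + snd (snd x) - fst (snd x)) < 1 \<and>
            z i t (fst (snd x)) (snd (snd x)) (fst x) \<in> rel_interior K"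
          using elim it by blast
      qed
    qed
  qed
  obtain U where U: "open U" "F \<subseteq> U"
    and evU: "\<forall>\<^sub>F y in nhds (0, 0). \<forall>p\<in>U. p \<in> K \<and> 0 < snd y \<longrightarrow>
      (\<exists>i<k. \<exists>t>0. t * (s i + snd y - fst y) < 1 \<and> z i t (fst y) (snd y) p \<in> rel_interior K)"
    using compact_eventually_uniform[OF cF(1) near_F] by auto
  obtain e where e: "e > 0"
    and eU: "\<And>y p. dist y (0, 0) < e \<Longrightarrow> p \<in> U \<Longrightarrow> p \<in> K \<Longrightarrow> 0 < snd y \<Longrightarrow>
      \<exists>i<k. \<exists>t>0. t * (s i + snd y - fst y) < 1 \<and> z i t (fst y) (snd y) p \<in> rel_interior K"
    using evU unfolding eventually_nhds_metric by blast
  \<comment> \<open>\<open>U\<close> and \<open>\<eta>\<close> are fixed before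
    \<open>\<epsilon>\<close>, whereas \<open>\<zeta>\<close> will depend on
    \<open>\<epsilon>\<close>; hence the uniform statement for all
    \<open>0 < \<zeta> \<le> \<eta>\<close>. The factor 1/4 gives
    \<open>\<eta> + \<zeta> < e\<close>.\<close>
  define \<eta> where "\<eta> = e / 4"
  have \<eta>: "0 < \<eta>" using e by (simp add: \<eta>_def)
  have near: "\<exists>i<k. \<exists>t>0. t * (s i + \<zeta> - \<eta>) < 1 \<and> z i t \<eta> \<zeta> p \<in> rel_interior K"
    if "0 < \<zeta>" "\<zeta> \<le> \<eta>" "p \<in> U" "p \<in> K" for \<zeta> p
  proof -
    have "norm (\<eta>, \<zeta>) \<le> norm \<eta> + norm \<zeta>" by (rule norm_Pair_le)
    also have "\<dots> < e" using that e by (simp add: \<eta>_def)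
    finally have "dist (\<eta>, \<zeta>) (0, 0) < e" by (simp add: dist_norm)
    from eU[OF this that(3,4)] that(1) show ?thesis by simp
  qed

  \<comment> \<open>Points away from the facet\<close>
  define M where "M = rel_frontier K - U"
  have "compact M"
    unfolding M_def using K U by (intro compact_diff compact_rel_frontier)
  \<comment> \<open>\<open>snd x\<close> is the later \<open>\<delta>\<close>. At the value 0, time
    1/2 along the field of \<open>(b, 1)\<close> leads from \<open>q\<close> to the midpoint of
    \<open>q\<close> and \<open>b\<close>, a relative interior point because \<open>q\<close> is not
    in \<open>F\<close>.\<close>
  have far: "\<forall>\<^sub>F x in nhds q \<times>\<^sub>F nhds 0. fst x \<in> K \<longrightarrow>
      1/2 * (1 - snd x) < 1 \<and>
      fst x + (1/2) *\<^sub>R ((b - snd x *\<^sub>R a) - (1 - snd x) *\<^sub>R fst x) \<in> rel_interior K" if "q \<in> M" for q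
  proof -
    have q: "q \<in> K" "q \<notin> F" using that U rfK by (auto simp: M_def)
    have mid: "midpoint q b \<in> rel_interior K"
      by (rule midpoint_facet_in_rel_interior[OF K(2) F(1,2) q b])
    let ?G = "nhds q \<times>\<^sub>F nhds (0::real)"
    let ?f = "\<lambda>x. fst x + (1/2) *\<^sub>R ((b - snd x *\<^sub>R a) - (1 - snd x) *\<^sub>R fst x)"
    have G: "?G = nhds (q, 0)" by (simp add: nhds_prod)
    have id: "((\<lambda>x. x) \<longlongrightarrow> (q, 0)) ?G"
      unfolding G by (rule filterlim_ident)
    have lim: "(fst \<longlongrightarrow> q) ?G" "(snd \<longlongrightarrow> 0) ?G"
      using tendsto_fst[OF id] tendsto_snd[OF id] by simp_all
    have "(?f \<longlongrightarrow> q + (1/2) *\<^sub>R ((b - 0 *\<^sub>R a) - (1 - 0) *\<^sub>R q)) ?G"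
      by (intro tendsto_intros lim)
    also have "q + (1/2) *\<^sub>R ((b - 0 *\<^sub>R a) - (1 - 0) *\<^sub>R q) = midpoint q b"
      by (simp add: midpoint_def algebra_simps flip: scaleR_left_distrib)
    finally have ev1: "\<forall>\<^sub>F x in ?G. ?f x \<in> affine hull K \<longrightarrow> ?f x \<in> rel_interior K"
      using mid by (rule eventually_in_rel_interior)
    have ev2: "\<forall>\<^sub>F x in ?G. - 1 < snd x"
      by (rule order_tendstoD(1)[OF lim(2)]) simp
    from ev1 ev2 show ?thesis
    proof eventually_elim
      case (elim x)
      show ?case
      proof (intro impI conjI)
        assume x: "fst x \<in> K"
        have "fst x + (1/2) *\<^sub>R (b - fst x) + (snd x / 2) *\<^sub>R (fst x - a) \<in> affine hull K"
          using x aK bK by (intro mem_affine_3_minus affine_affine_hull) (auto intro: hull_inc)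
        then have "?f x \<in> affine hull K" by (simp add: algebra_simps)
        then show "?f x \<in> rel_interior K" using elim by blast
      qed (use elim in simp)
    qed
  qed
  then have evM: "\<forall>\<^sub>F \<delta> in nhds 0. \<forall>p\<in>M. p \<in> K \<longrightarrow>
      1/2 * (1 - \<delta>) < 1 \<and> p + (1/2) *\<^sub>R ((b - \<delta> *\<^sub>R a) - (1 - \<delta>) *\<^sub>R p) \<in> rel_interior K"
    using compact_eventually_uniform[OF \<open>compact M\<close> far]
    by (smt (verit, best) eventually_mono fst_conv snd_conv subset_iff)

  \<comment> \<open>The new linear form and the choice of the parameters\<close>
  have denom: "\<forall>\<^sub>F x in nhds q \<times>\<^sub>F at_right 0. fst x \<in> K \<longrightarrow>
      0 < snd x * (\<alpha> \<bullet> fst x + c) + (h \<bullet> fst x - d)" if "q \<in> K" for q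
  proof -
    let ?G = "nhds q \<times>\<^sub>F at_right (0::real)"
    have lim: "(fst \<longlongrightarrow> q) ?G" "filterlim snd (at_right 0) ?G"
      by (rule filterlim_fst filterlim_snd)+
    have lim': "(snd \<longlongrightarrow> 0) ?G"
      using lim(2) by (simp add: filterlim_at)
    have ev: "\<forall>\<^sub>F x in ?G. 0 < snd x"
      using lim(2) eventually_at_right_less[of "0::real"] by (auto simp: filterlim_iff)
    \<comment> \<open>Near \<open>F\<close> the old form is positive, the height is nonnegative and
      \<open>\<epsilon> > 0\<close>. At other points the height is positive and dominates as
      \<open>\<epsilon>\<close> tends to 0.\<close>
    show ?thesis
    proof (cases "q \<in> F")
      case True
      have "((\<lambda>x. \<alpha> \<bullet> fst x + c) \<longlongrightarrow> \<alpha> \<bullet> q + c) ?G"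
        by (intro tendsto_intros lim)
      then have "\<forall>\<^sub>F x in ?G. 0 < \<alpha> \<bullet> fst x + c"
        by (rule order_tendstoD(1)) (use pos[OF True] in simp)
      with ev show ?thesis
        by eventually_elim (use hK in \<open>fastforce intro: add_pos_nonneg\<close>)
    next
      case False
      then have "d < h \<bullet> q" using hK[OF that] Fh that by force
      have "((\<lambda>x. snd x * (\<alpha> \<bullet> fst x + c) + (h \<bullet> fst x - d)) \<longlongrightarrow>
          0 * (\<alpha> \<bullet> q + c) + (h \<bullet> q - d)) ?G"
        by (intro tendsto_intros lim lim')
      then have "\<forall>\<^sub>F x in ?G. 0 < snd x * (\<alpha> \<bullet> fst x + c) + (h \<bullet> fst x - d)"
        by (rule order_tendstoD(1)) (use \<open>d < h \<bullet> q\<close> in simp)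
      then show ?thesis by eventually_elim simp
    qed
  qed
  have evK: "\<forall>\<^sub>F \<epsilon> in at_right 0. \<forall>p\<in>K. 0 < \<epsilon> * (\<alpha> \<bullet> p + c) + (h \<bullet> p - d)"
  proof -
    obtain V where "K \<subseteq> V" and V: "\<forall>\<^sub>F \<epsilon> in at_right 0. \<forall>p\<in>V. p \<in> K \<longrightarrow>
        0 < \<epsilon> * (\<alpha> \<bullet> p + c) + (h \<bullet> p - d)"
      using compact_eventually_uniform[OF K(1) denom] by auto
    from V show ?thesis by eventually_elim (use \<open>K \<subseteq> V\<close> in blast)
  qed

  \<comment> \<open>The quotient of the values of the new form at \<open>b\<close> and at
    \<open>a\<close>, so that the form vanishes on \<open>(b - \<delta> \<epsilon> *\<^sub>R a, 1 -
    \<delta> \<epsilon>)\<close>. It tends to 0 because \<open>b\<close> has height 0 and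
    \<open>a\<close> has positive height.\<close>
  define \<delta> where "\<delta> \<epsilon> = \<epsilon> * (\<alpha> \<bullet> b + c) / (\<epsilon> * (\<alpha> \<bullet> a + c) + (h \<bullet> a - d))" for \<epsilon>
  have "(\<delta> \<longlongrightarrow> 0 * (\<alpha> \<bullet> b + c) / (0 * (\<alpha> \<bullet> a + c) + (h \<bullet> a - d))) (at_right 0)"
    unfolding \<delta>_def using ha by (intro tendsto_intros) auto
  then have \<delta>_lim: "(\<delta> \<longlongrightarrow> 0) (at_right 0)" by simp
  have "\<forall>\<^sub>F \<epsilon> in at_right 0. \<delta> \<epsilon> < 1"
    by (rule order_tendstoD(2)[OF \<delta>_lim]) simp
  moreover have "\<forall>\<^sub>F \<epsilon> in at_right 0. \<forall>p\<in>M. p \<in> K \<longrightarrow> 1/2 * (1 - \<delta> \<epsilon>) < 1 \<and>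
      p + (1/2) *\<^sub>R ((b - \<delta> \<epsilon> *\<^sub>R a) - (1 - \<delta> \<epsilon>) *\<^sub>R p) \<in> rel_interior K"
    using \<delta>_lim evM unfolding filterlim_iff by blast
  moreover have "\<forall>\<^sub>F \<epsilon> in at_right (0::real). 0 < \<epsilon>"
    by (rule eventually_at_right_less)
  ultimately have "\<forall>\<^sub>F \<epsilon> in at_right 0. 0 < \<epsilon> \<and> \<delta> \<epsilon> < 1 \<and>
      (\<forall>p\<in>M. p \<in> K \<longrightarrow> 1/2 * (1 - \<delta> \<epsilon>) < 1 \<and>
        p + (1/2) *\<^sub>R ((b - \<delta> \<epsilon> *\<^sub>R a) - (1 - \<delta> \<epsilon>) *\<^sub>R p) \<in> rel_interior K) \<and>
      (\<forall>p\<in>K. 0 < \<epsilon> * (\<alpha> \<bullet> p + c) + (h \<bullet> p - d))"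
    using evK by eventually_elim blast
  then obtain \<epsilon> where \<epsilon>: "0 < \<epsilon>" "\<delta> \<epsilon> < 1"
    and farM: "\<And>p. p \<in> M \<Longrightarrow> p \<in> K \<Longrightarrow> 1/2 * (1 - \<delta> \<epsilon>) < 1 \<and>
        p + (1/2) *\<^sub>R ((b - \<delta> \<epsilon> *\<^sub>R a) - (1 - \<delta> \<epsilon>) *\<^sub>R p) \<in> rel_interior K"
    and posK: "\<And>p. p \<in> K \<Longrightarrow> 0 < \<epsilon> * (\<alpha> \<bullet> p + c) + (h \<bullet> p - d)"
    using eventually_happens'[OF trivial_limit_at_right_real] by blast
  define L where "L = (\<lambda>x. \<epsilon> * (\<alpha> \<bullet> x + c) + (h \<bullet> x - d))"
  have La: "0 < L a" and Lb: "L b = \<epsilon> * (\<alpha> \<bullet> b + c)"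
    using posK[OF aK] hb by (auto simp: L_def)
  have \<delta>L: "\<delta> \<epsilon> * L a = L b"
    using La by (simp add: \<delta>_def Lb) (simp add: L_def)
  have \<delta>0: "0 < \<delta> \<epsilon>"
    unfolding \<delta>_def using \<epsilon> pos[OF bF] posK[OF aK] by (intro divide_pos_pos mult_pos_pos)
  \<comment> \<open>With this value the correction of the old pairs is exactly
    \<open>- \<eta>\<close> times the new pair, and so it stays in the kernel of the new form. The
    new pair gets the index \<open>k\<close>.\<close>
  define \<zeta> where "\<zeta> = \<eta> * \<delta> \<epsilon>"
  have \<zeta>: "0 < \<zeta>" "\<zeta> \<le> \<eta>" using \<eta> \<epsilon> \<delta>0 by (auto simp: \<zeta>_def mult_le_cancel_left1)
  define w' where "w' i = (if i < k then w i + \<zeta> *\<^sub>R a - \<eta> *\<^sub>R b else b - \<delta> \<epsilon> *\<^sub>R a)" for i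
  define s' where "s' i = (if i < k then s i + \<zeta> - \<eta> else 1 - \<delta> \<epsilon>)" for i
  have L_hom: "(\<epsilon> *\<^sub>R \<alpha> + h) \<bullet> x + (\<epsilon> * c - d) = L x" for x
    by (simp add: L_def inner_simps algebra_simps)
  show ?thesis
    unfolding proj_illuminable_def
  proof (intro exI[of _ "\<epsilon> *\<^sub>R \<alpha> + h"] exI[of _ "\<epsilon> * c - d"] exI[of _ w'] exI[of _ s'] conjI ballI allI impI)
    fix x assume "x \<in> K"
    then show "0 < (\<epsilon> *\<^sub>R \<alpha> + h) \<bullet> x + (\<epsilon> * c - d)"
      using posK unfolding L_hom L_def by simp
  next
    fix i assume i: "i < Suc k"
    show "(\<epsilon> *\<^sub>R \<alpha> + h) \<bullet> w' i + (\<epsilon> * c - d) * s' i = 0"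
    proof (cases "i < k")
      case True
      have "(\<epsilon> *\<^sub>R \<alpha> + h) \<bullet> w' i + (\<epsilon> * c - d) * s' i =
          \<epsilon> * (\<alpha> \<bullet> w i + c * s i) + (h \<bullet> w i - d * s i) + \<zeta> * L a - \<eta> * L b"
        using True by (simp add: w'_def s'_def L_def inner_simps algebra_simps)
      also have "\<dots> = 0"
        using ker[OF True] kerh[OF True] \<delta>L by (simp add: \<zeta>_def mult.assoc)
      finally show ?thesis .
    next
      case False
      have "(\<epsilon> *\<^sub>R \<alpha> + h) \<bullet> w' i + (\<epsilon> * c - d) * s' i = L b - \<delta> \<epsilon> * L a"
        using False by (simp add: w'_def s'_def L_def inner_simps algebra_simps)
      then show ?thesis using \<delta>L by simp
    qed
  next
    fix i p assume "i < Suc k" and p: "p \<in> affine hull K"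
    show "p + (w' i - s' i *\<^sub>R p) \<in> affine hull K"
    proof (cases "i < k")
      case True
      then show ?thesis
        using z_aff[OF True p, of 1 \<eta> \<zeta>] by (simp add: z_def w'_def s'_def)
    next
      case False
      have "p + 1 *\<^sub>R (b - p) + \<delta> \<epsilon> *\<^sub>R (p - a) \<in> affine hull K"
        using p aK bK by (intro mem_affine_3_minus affine_affine_hull) (auto intro: hull_inc)
      then show ?thesis using False by (simp add: w'_def s'_def algebra_simps)
    qed
  next
    fix p assume p: "p \<in> rel_frontier K"
    then have pK: "p \<in> K" using rfK by blast
    show "\<exists>i<Suc k. \<exists>t>0. t * s' i < 1 \<and> p + t *\<^sub>R (w' i - s' i *\<^sub>R p) \<in> rel_interior K"
    proof (cases "p \<in> U")
      case True
      obtain i t where it: "i < k" "t > 0" "t * (s i + \<zeta> - \<eta>) < 1" "z i t \<eta> \<zeta> p \<in> rel_interior K"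
        using near[OF \<zeta> True pK] by blast
      then show ?thesis
        by (intro exI[of _ i] exI[of _ t] conjI) (auto simp: w'_def s'_def z_def)
    next
      case False
      then have "p \<in> M" using p by (simp add: M_def)
      from farM[OF this pK] show ?thesis
        by (intro exI[of _ k] exI[of _ "1/2"] conjI) (simp_all add: w'_def s'_def)
    qed
  qed
qed

section \<open>Convex bodies in the plane\<close>

text \<open>The Gram determinant, that is, the squared area of the parallelogram spanned by
  \<open>u\<close> and \<open>v\<close>. It measures area in a plane inside a space of any dimension
  and is polynomial, hence continuous.\<close>

definition gram :: "'a::euclidean_space \<Rightarrow> 'a \<Rightarrow> real" where
  "gram u v = (u \<bullet> u) * (v \<bullet> v) - (u \<bullet> v)\<^sup>2"

lemma gram_nonneg: "0 \<le> gram u v"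
  using Cauchy_Schwarz_ineq[of u v] by (simp add: gram_def)

text \<open>The equality case of the Cauchy-Schwarz inequality.\<close>

lemma gram_eq_0_iff: "gram u v = 0 \<longleftrightarrow> collinear {0, u, v}"
proof -
  have "gram u v = (norm u * norm v)\<^sup>2 - \<bar>u \<bullet> v\<bar>\<^sup>2"
    by (simp add: gram_def power_mult_distrib power2_norm_eq_inner)
  then have "gram u v = 0 \<longleftrightarrow> \<bar>u \<bullet> v\<bar>\<^sup>2 = (norm u * norm v)\<^sup>2" by auto
  also have "\<dots> \<longleftrightarrow> \<bar>u \<bullet> v\<bar> = norm u * norm v"
    by (rule power2_eq_iff_nonneg) simp_all
  finally show ?thesis by (simp add: norm_cauchy_schwarz_equal)
qed

text \<open>Shearing along \<open>v\<close> keeps the area, and scaling \<open>u\<close> by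
  \<open>r\<close> multiplies the squared area by \<open>r\<^sup>2\<close>.\<close>

lemma gram_linear_combination: "gram (r *\<^sub>R u + m *\<^sub>R v) v = r\<^sup>2 * gram u v"
  unfolding gram_def
  by (simp add: inner_add_left inner_add_right inner_commute[of v u] power2_eq_square algebra_simps)

lemma gram_triangle_commute: "gram (b - a) (c - a) = gram (a - b) (c - b)"
  unfolding gram_def
  by (simp add: inner_diff_left inner_diff_right inner_commute[of b a] inner_commute[of c a]
      inner_commute[of c b] power2_eq_square algebra_simps)

lemma gram_triangle_swap: "gram (b - a) (c - a) = gram (c - a) (b - a)"
  by (simp add: gram_def inner_commute)

lemma gram_triangle_eq_0_iff: "gram (b - a) (c - a) = 0 \<longleftrightarrow> collinear {a, b, c}"
  using collinear_3[of b a c] by (simp add: gram_eq_0_iff insert_commute)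

text \<open>
  The triangle has maximal area; the moduli of barycentric coordinates are ratios of areas.
\<close>

lemma max_inscribed_triangle:
  fixes K :: "'a::euclidean_space set"
  assumes "compact K" "aff_dim K = 2"
  obtains a b c where "a \<in> K" "b \<in> K" "c \<in> K"
    "\<And>q. q \<in> K \<Longrightarrow> \<exists>x y z. q = x *\<^sub>R a + y *\<^sub>R b + z *\<^sub>R c \<and> x + y + z = 1 \<and>
       x \<le> 1 \<and> y \<le> 1 \<and> z \<le> 1"
proof -
  let ?A = "\<lambda>(a, b, c). gram (b - a) (c - a)"
  let ?K = "K \<times> K \<times> K"
  have ne: "?K \<noteq> {}" using assms by auto
  have "compact ?K" using assms by (intro compact_Times)
  moreover have "continuous_on ?K ?A"
    unfolding gram_def case_prod_beta by (intro continuous_intros)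
  ultimately have "\<exists>t\<in>?K. \<forall>y\<in>?K. ?A y \<le> ?A t"
    using ne by (intro continuous_attains_sup)
  then obtain a b c where abc: "a \<in> K" "b \<in> K" "c \<in> K"
    and max: "\<And>a' b' c'. a' \<in> K \<Longrightarrow> b' \<in> K \<Longrightarrow> c' \<in> K \<Longrightarrow>
      gram (b' - a') (c' - a') \<le> gram (b - a) (c - a)"
    by auto
  \<comment> \<open>Three affinely independent points of \<open>K\<close> show that the maximal area
    is positive, so that areas can be compared by ratios.\<close>
  obtain B where B: "B \<subseteq> K" "\<not> affine_dependent B" "affine hull K = affine hull B"
    using affine_basis_exists by metis
  then have dimB: "aff_dim B = 2" using assms aff_dim_affine_hull by metis
  then have "card B = 3" using aff_dim_affine_independent[OF B(2)] by simp
  then obtain a' b' c' where B': "B = {a', b', c'}"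
    by (auto simp: card_3_iff)
  then have "\<not> collinear {a', b', c'}" using dimB by (simp add: collinear_aff_dim)
  then have "0 < gram (b' - a') (c' - a')"
    using gram_triangle_eq_0_iff gram_nonneg[of "b' - a'" "c' - a'"] by (metis less_eq_real_def)
  also have "\<dots> \<le> gram (b - a) (c - a)" using B(1) B' by (intro max) auto
  finally have pos: "0 < gram (b - a) (c - a)" .
  then have "\<not> collinear {a, b, c}" using gram_triangle_eq_0_iff by (metis less_irrefl)
  then have "2 \<le> aff_dim {a, b, c}" by (simp add: collinear_aff_dim)
  moreover have sub: "{a, b, c} \<subseteq> K" using abc by simp
  moreover have "aff_dim {a, b, c} \<le> 2" using aff_dim_subset[OF sub] assms by simp
  ultimately have hull: "affine hull {a, b, c} = affine hull K"
    using assms by (intro affine_dim_equal) (auto simp: hull_mono)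
  \<comment> \<open>Replacing one vertex by \<open>q\<close> multiplies the squared area by the
    square of the coordinate of \<open>q\<close> at that vertex; maximality bounds this factor by
    1.\<close>
  have small: "r \<le> 1" if "r\<^sup>2 * gram (b - a) (c - a) \<le> gram (b - a) (c - a)" for r
  proof -
    have "r\<^sup>2 \<le> 1" using that pos by (simp add: mult_le_cancel_right1)
    then show ?thesis by (simp add: abs_square_le_1)
  qed
  show thesis
  proof (rule that[OF abc])
    fix q assume q: "q \<in> K"
    then have "q \<in> affine hull {a, b, c}" using hull hull_inc by fast
    then obtain x y z where xyz: "q = x *\<^sub>R a + y *\<^sub>R b + z *\<^sub>R c" "x + y + z = 1"
      by (auto simp: affine_hull_3)
    have x: "x = 1 - y - z" using xyz by simp
    have "q - a = y *\<^sub>R (b - a) + z *\<^sub>R (c - a)"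
      unfolding xyz(1) x by (simp add: algebra_simps)
    then have "gram (q - a) (c - a) = y\<^sup>2 * gram (b - a) (c - a)"
      by (simp add: gram_linear_combination)
    then have "y \<le> 1" using max[OF abc(1) q abc(3)] by (intro small) simp
    have "q - a = z *\<^sub>R (c - a) + y *\<^sub>R (b - a)"
      unfolding xyz(1) x by (simp add: algebra_simps)
    then have "gram (q - a) (b - a) = z\<^sup>2 * gram (b - a) (c - a)"
      by (simp add: gram_linear_combination gram_triangle_swap[of b])
    then have "z \<le> 1" using max[OF abc(1) q abc(2)] by (intro small) simp
    have y: "y = 1 - x - z" using xyz by simp
    have "q - b = x *\<^sub>R (a - b) + z *\<^sub>R (c - b)"
      unfolding xyz(1) y by (simp add: algebra_simps)
    then have "gram (q - b) (c - b) = x\<^sup>2 * gram (b - a) (c - a)"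
      by (simp add: gram_linear_combination gram_triangle_commute[of b])
    then have "x \<le> 1" using max[OF abc(2) q abc(3)] by (intro small) simp
    show "\<exists>x y z. q = x *\<^sub>R a + y *\<^sub>R b + z *\<^sub>R c \<and> x + y + z = 1 \<and> x \<le> 1 \<and> y \<le> 1 \<and> z \<le> 1"
      using xyz \<open>x \<le> 1\<close> \<open>y \<le> 1\<close> \<open>z \<le> 1\<close> by blast
  qed
qed

text \<open>No projective change is made: the form is constant 1 and all \<open>s i\<close> are 0.
  By strict convexity it suffices to reach a second point of \<open>K\<close> along a direction,
  since the midpoint is then in the relative interior. The directions are the edges of the triangle
  in cyclic order, each moving weight from one vertex to the next.\<close>

lemma proj_illuminable_strictly_convex_plane:
  fixes K :: "'a::euclidean_space set"
  assumes K: "compact K" "convex K" "aff_dim K = 2"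
    and strict: "\<And>x y. x \<in> K \<Longrightarrow> y \<in> K \<Longrightarrow> open_segment x y \<subseteq> rel_interior K"
  shows "proj_illuminable K 3"
proof -
  obtain a b c where abc: "a \<in> K" "b \<in> K" "c \<in> K"
    and bary: "\<And>q. q \<in> K \<Longrightarrow> \<exists>x y z. q = x *\<^sub>R a + y *\<^sub>R b + z *\<^sub>R c \<and> x + y + z = 1 \<and>
       x \<le> 1 \<and> y \<le> 1 \<and> z \<le> 1"
    using max_inscribed_triangle[OF K(1,3)] by metis
  have K3: "affine hull {a, b, c} = affine hull K"
  proof
    have "K \<subseteq> affine hull {a, b, c}" using bary by (fastforce simp: affine_hull_3)
    then show "affine hull K \<subseteq> affine hull {a, b, c}" by (simp add: hull_minimal)
    show "affine hull {a, b, c} \<subseteq> affine hull K" using abc by (intro hull_mono) auto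
  qed
  then have "aff_dim {a, b, c} = 2" using K(3) aff_dim_affine_hull by metis
  then have "\<not> collinear {a, b, c}" by (simp add: collinear_aff_dim)
  then have ne: "a \<noteq> b" "b \<noteq> c" "c \<noteq> a" by (auto simp: insert_commute)
  have inK: "x *\<^sub>R a + y *\<^sub>R b + z *\<^sub>R c \<in> K" if "0 \<le> x" "0 \<le> y" "0 \<le> z" "x + y + z = 1" for x y z
  proof -
    have "x *\<^sub>R a + y *\<^sub>R b + z *\<^sub>R c \<in> convex hull {a, b, c}"
      using that by (auto simp: convex_hull_3)
    also have "\<dots> \<subseteq> K" using K abc by (intro hull_minimal) auto
    finally show ?thesis .
  qed
  define w where "w i = (if i = 0 then b - a else if i = 1 then c - b else a - c)" for i :: nat
  have mid: "p + (t / 2) *\<^sub>R v \<in> rel_interior K"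
    if "p \<in> K" "t > 0" "v \<noteq> 0" "p + t *\<^sub>R v \<in> K" for p v :: 'a and t :: real
  proof -
    have "p + (t / 2) *\<^sub>R v = midpoint p (p + t *\<^sub>R v)"
      by (simp add: midpoint_def algebra_simps flip: scaleR_left_distrib)
    moreover have "midpoint p (p + t *\<^sub>R v) \<in> open_segment p (p + t *\<^sub>R v)" using that by simp
    ultimately show ?thesis using strict that by (metis subsetD)
  qed
  have illum: "\<exists>i<3. \<exists>t>0. p + t *\<^sub>R w i \<in> rel_interior K" if p: "p \<in> K" for p
  proof -
    obtain x y z where xyz: "p = x *\<^sub>R a + y *\<^sub>R b + z *\<^sub>R c" "x + y + z = 1" "x \<le> 1" "y \<le> 1" "z \<le> 1"
      using bary[OF p] by blast
    have move: "p + t *\<^sub>R (b - a) = (x - t) *\<^sub>R a + (y + t) *\<^sub>R b + z *\<^sub>R c"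
      "p + t *\<^sub>R (c - b) = x *\<^sub>R a + (y - t) *\<^sub>R b + (z + t) *\<^sub>R c"
      "p + t *\<^sub>R (a - c) = (x + t) *\<^sub>R a + y *\<^sub>R b + (z - t) *\<^sub>R c" for t
      by (simp_all add: xyz(1) algebra_simps)
    have "(\<exists>t>0. p + t *\<^sub>R (b - a) \<in> K) \<or> (\<exists>t>0. p + t *\<^sub>R (c - b) \<in> K) \<or> (\<exists>t>0. p + t *\<^sub>R (a - c) \<in> K)"
    proof -
      \<comment> \<open>If \<open>y < 0\<close>, moving by \<open>- y\<close> along
        \<open>b - a\<close> makes the coordinate at \<open>b\<close> zero; the others become
        \<open>x + y = 1 - z \<ge> 0\<close> and \<open>z = 1 - x - y > 0\<close>. The next two
        cases are cyclic copies. A point of the triangle can pass a positive weight to the next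
        vertex.\<close>
      consider "y < 0" | "z < 0" | "x < 0" | "0 \<le> x" "0 \<le> y" "0 \<le> z" "0 < x \<or> 0 < y \<or> 0 < z"
        using xyz by linarith
      then show ?thesis
      proof cases
        case 1
        then have "p + (- y) *\<^sub>R (b - a) \<in> K" unfolding move using xyz by (intro inK) auto
        then show ?thesis using 1 by (metis neg_0_less_iff_less)
      next
        case 2
        then have "p + (- z) *\<^sub>R (c - b) \<in> K" unfolding move using xyz by (intro inK) auto
        then show ?thesis using 2 by (metis neg_0_less_iff_less)
      next
        case 3
        then have "p + (- x) *\<^sub>R (a - c) \<in> K" unfolding move using xyz by (intro inK) auto
        then show ?thesis using 3 by (metis neg_0_less_iff_less)
      next
        case 4
        have "p + x *\<^sub>R (b - a) \<in> K" "p + y *\<^sub>R (c - b) \<in> K" "p + z *\<^sub>R (a - c) \<in> K"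
          unfolding move by (intro inK; use 4 xyz(2) in simp)+
        then show ?thesis using 4(4) by blast
      qed
    qed
    moreover have "w 0 = b - a" "w 1 = c - b" "w 2 = a - c" "(0::nat) < 3" "(1::nat) < 3" "(2::nat) < 3"
      by (simp_all add: w_def)
    ultimately obtain i t where "i < 3" "t > 0" "p + t *\<^sub>R w i \<in> K"
      by metis
    moreover have "w i \<noteq> 0" using ne by (auto simp: w_def)
    ultimately show ?thesis using mid[OF p] by (metis half_gt_zero)
  qed
  have aff: "p + w i \<in> affine hull K" if "p \<in> affine hull K" for p i
  proof -
    have "p + 1 *\<^sub>R (x - y) \<in> affine hull K" if "x \<in> K" "y \<in> K" for x y
      using that \<open>p \<in> affine hull K\<close>
      by (intro mem_affine_3_minus affine_affine_hull) (auto intro: hull_inc)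
    then show ?thesis using abc by (simp add: w_def)
  qed
  have "rel_frontier K \<subseteq> K"
    using K by (auto simp: rel_frontier_def compact_imp_closed)
  then show ?thesis
    unfolding proj_illuminable_def
    using illum aff by (intro exI[of _ 0] exI[of _ 1] exI[of _ w] exI[of _ "\<lambda>_. 0"]) auto
qed

section \<open>Projective images\<close>

text \<open>Preserving open segments in both directions transfers convexity and faces, and
  invariance of domain transfers interiors, hence frontiers. The maps are controlled only on open
  convex sets \<open>D\<close> and \<open>E\<close> because a projective map is regular only off a
  hyperplane.\<close>

lemma combinatorially_equivalent_image:
  fixes K :: "'a::euclidean_space set"
  assumes K: "convex_body K" "K \<subseteq> D"
    and D: "open D" "convex D" and E: "open E" "convex E"
    and f: "continuous_on D f" "\<And>x. x \<in> D \<Longrightarrow> f x \<in> E" "\<And>x. x \<in> D \<Longrightarrow> g (f x) = x"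
    and g: "continuous_on E g" "\<And>x. x \<in> E \<Longrightarrow> g x \<in> D" "\<And>x. x \<in> E \<Longrightarrow> f (g x) = x"
    and fseg: "\<And>x y z. x \<in> D \<Longrightarrow> y \<in> D \<Longrightarrow> z \<in> open_segment x y \<Longrightarrow> f z \<in> open_segment (f x) (f y)"
    and gseg: "\<And>x y z. x \<in> E \<Longrightarrow> y \<in> E \<Longrightarrow> z \<in> open_segment x y \<Longrightarrow> g z \<in> open_segment (g x) (g y)"
  shows "combinatorially_equivalent K (f ` K)" "frontier (f ` K) = f ` frontier K"
    "interior (f ` K) = f ` interior K"
proof -
  have cK: "compact K" "convex K" "interior K \<noteq> {}" using K by (auto simp: convex_body_def)
  have injf: "inj_on f D" using f(3) by (metis inj_onI)
  have injg: "inj_on g E" using g(3) by (metis inj_onI)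
  have fKE: "f ` K \<subseteq> E" using K f by blast
  have gf: "g ` f ` S = S" if "S \<subseteq> K" for S
    using that K f(3) by (force simp: image_iff)
  have iK: "interior K \<subseteq> D" using K interior_subset by blast
  show int: "interior (f ` K) = f ` interior K"
  proof
    have "open (f ` interior K)"
      using iK by (intro invariance_of_domain continuous_on_subset[OF f(1)] inj_on_subset[OF injf]) auto
    then show "f ` interior K \<subseteq> interior (f ` K)"
      by (intro interior_maximal image_mono interior_subset)
    have sub: "interior (f ` K) \<subseteq> E" using fKE interior_subset by blast
    then have "open (g ` interior (f ` K))"
      by (intro invariance_of_domain continuous_on_subset[OF g(1)] inj_on_subset[OF injg]) auto
    moreover have "g ` interior (f ` K) \<subseteq> K"
      using image_mono[OF interior_subset, of g "f ` K"] gf[of K] by simp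
    ultimately have "g ` interior (f ` K) \<subseteq> interior K" by (rule interior_maximal[rotated])
    then have "f ` g ` interior (f ` K) \<subseteq> f ` interior K" by (rule image_mono)
    moreover have "f ` g ` interior (f ` K) = interior (f ` K)"
      using sub g(3) by (force simp: image_iff)
    ultimately show "interior (f ` K) \<subseteq> f ` interior K" by simp
  qed
  have cfK: "compact (f ` K)"
    using cK K by (intro compact_continuous_image continuous_on_subset[OF f(1)])
  have convfK: "convex (f ` K)"
    unfolding convex_contains_open_segment
  proof clarify
    fix x y z assume xy: "x \<in> K" "y \<in> K" and z: "z \<in> open_segment (f x) (f y)"
    have "g z \<in> open_segment x y"
      using gseg[OF _ _ z] f xy K by (metis subsetD)
    then have "g z \<in> K" using cK xy convex_contains_open_segment by blast
    moreover have "z \<in> E"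
      using z E(2) xy fKE convex_contains_open_segment[of E] by blast
    ultimately show "z \<in> f ` K" using g(3) by (metis imageI)
  qed
  have fr: "frontier K = K - interior K" "frontier (f ` K) = f ` K - interior (f ` K)"
    using cK cfK by (auto simp: frontier_def compact_imp_closed)
  show fr_im: "frontier (f ` K) = f ` frontier K"
    unfolding fr int using K interior_subset[of K] by (auto dest: inj_onD[OF injf])
  have frK: "frontier K \<subseteq> K" using fr by blast
  have "homeomorphism (frontier K) (frontier (f ` K)) f g"
    unfolding homeomorphism_def
  proof (intro conjI ballI)
    show "f ` frontier K = frontier (f ` K)" by (rule fr_im[symmetric])
    show "g ` frontier (f ` K) = frontier K" unfolding fr_im by (rule gf[OF frK])
    show "continuous_on (frontier K) f" using frK K by (intro continuous_on_subset[OF f(1)]) auto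
    show "continuous_on (frontier (f ` K)) g"
      using fr fKE by (intro continuous_on_subset[OF g(1)]) auto
    show "g (f x) = x" if "x \<in> frontier K" for x using that frK K f(3) by blast
    show "f (g y) = y" if "y \<in> frontier (f ` K)" for y using that fr fKE g(3) by blast
  qed
  moreover have "X face_of K \<longleftrightarrow> f ` X face_of f ` K" if X: "X \<subseteq> frontier K" for X
  proof -
    have XK: "X \<subseteq> K" using X frK by blast
    show ?thesis
    proof
      assume face: "X face_of K"
      show "f ` X face_of f ` K"
        unfolding face_of_def
      proof (intro conjI ballI impI)
        show "f ` X \<subseteq> f ` K" using XK by blast
        show "convex (f ` X)"
          unfolding convex_contains_open_segment
        proof clarify
          fix x y z assume xy: "x \<in> X" "y \<in> X" and z: "z \<in> open_segment (f x) (f y)"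
          have "g z \<in> open_segment x y"
            using gseg[OF _ _ z] f xy K XK by (metis subsetD)
          then have "g z \<in> X"
            using face_of_imp_convex[OF face] xy convex_contains_open_segment by blast
          moreover have "z \<in> E"
            using z E(2) xy fKE XK convex_contains_open_segment[of E] by blast
          ultimately show "z \<in> f ` X" using g(3) by (metis imageI)
        qed
        fix a' b' x' assume *: "a' \<in> f ` K" "b' \<in> f ` K" "x' \<in> f ` X" "x' \<in> open_segment a' b'"
        then obtain a b x where abx: "a \<in> K" "b \<in> K" "x \<in> X" "a' = f a" "b' = f b" "x' = f x" by blast
        then have "x \<in> open_segment a b"
          using gseg[of a' b' x'] * f K XK by (metis subsetD)
        then have "a \<in> X \<and> b \<in> X" using face_ofD[OF face, of x a b] abx by blast
        then show "a' \<in> f ` X" "b' \<in> f ` X" using abx by blast+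
      qed
    next
      assume face: "f ` X face_of f ` K"
      show "X face_of K"
        unfolding face_of_def
      proof (intro conjI ballI impI)
        show "X \<subseteq> K" by (rule XK)
        have reflect: "x \<in> X" if "x \<in> K" "f x \<in> f ` X" for x
        proof -
          obtain x' where "x' \<in> X" "f x = f x'" using \<open>f x \<in> f ` X\<close> by blast
          then show ?thesis using inj_onD[OF injf, of x x'] \<open>x \<in> K\<close> XK K(2) by blast
        qed
        show "convex X"
          unfolding convex_contains_open_segment
        proof clarify
          fix x y z assume xy: "x \<in> X" "y \<in> X" and z: "z \<in> open_segment x y"
          have "f z \<in> open_segment (f x) (f y)"
            using fseg[OF _ _ z] xy K XK by blast
          then have "f z \<in> f ` X"
            using face_of_imp_convex[OF face] xy convex_contains_open_segment by blast
          moreover have "z \<in> K"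
            using z cK(2) xy XK convex_contains_open_segment[of K] by blast
          ultimately show "z \<in> X" using reflect by blast
        qed
        fix a b x assume *: "a \<in> K" "b \<in> K" "x \<in> X" "x \<in> open_segment a b"
        then have "f x \<in> open_segment (f a) (f b)" using fseg K by blast
        then have "f a \<in> f ` X \<and> f b \<in> f ` X"
          using face_ofD[OF face, of "f x" "f a" "f b"] * by blast
        then show "a \<in> X" "b \<in> X" using reflect * by blast+
      qed
    qed
  qed
  moreover have "convex_body (f ` K)"
    using cfK convfK int cK(3) by (simp add: convex_body_def)
  ultimately show "combinatorially_equivalent K (f ` K)"
    using K(1) unfolding combinatorially_equivalent_def by blast
qed

text \<open>Division by \<open>L\<close> turns the weights \<open>1 - u\<close> and \<open>u\<close>
  into weights proportional to \<open>(1 - u) * L x\<close> and \<open>u * L y\<close>, which remain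
  positive.\<close>

lemma fractional_map_open_segment:
  fixes A :: "'a::real_vector \<Rightarrow> 'b::real_vector"
  assumes A: "\<And>x y u. A ((1 - u) *\<^sub>R x + u *\<^sub>R y) = (1 - u) *\<^sub>R A x + u *\<^sub>R A y"
    and L: "\<And>x y u. L ((1 - u) *\<^sub>R x + u *\<^sub>R y) = (1 - u) * L x + u * L y"
    and pos: "0 < L x" "0 < L y" and ne: "A x /\<^sub>R L x \<noteq> A y /\<^sub>R L y" and z: "z \<in> open_segment x y"
  shows "A z /\<^sub>R L z \<in> open_segment (A x /\<^sub>R L x) (A y /\<^sub>R L y)"
proof -
  obtain u where u: "0 < u" "u < 1" "z = (1 - u) *\<^sub>R x + u *\<^sub>R y"
    using z by (auto simp: in_segment)
  have Lz: "L z = (1 - u) * L x + u * L y" by (simp add: u(3) L)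
  have p: "0 < (1 - u) * L x" "0 < u * L y" using u pos by auto
  define v where "v = u * L y / L z"
  have v: "0 < v" "v < 1" "1 - v = (1 - u) * L x / L z"
    using p by (auto simp: v_def Lz field_simps)
  have Az: "A z = (1 - u) *\<^sub>R A x + u *\<^sub>R A y" by (simp only: u(3) A)
  have "A z /\<^sub>R L z = ((1 - u) / L z) *\<^sub>R A x + (u / L z) *\<^sub>R A y"
    by (simp add: Az scaleR_right_distrib divide_inverse mult.commute)
  also have "\<dots> = (1 - v) *\<^sub>R (A x /\<^sub>R L x) + v *\<^sub>R (A y /\<^sub>R L y)"
  proof -
    have "(1 - v) * inverse (L x) = (1 - u) / L z" using pos by (simp add: v(3))
    moreover have "v * inverse (L y) = u / L z" using pos by (simp add: v_def)
    ultimately show ?thesis by simp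
  qed
  finally show ?thesis
    unfolding in_segment using v ne by blast
qed

lemma illuminated_from_normalized:
  assumes "t > 0" "p + t *\<^sub>R v \<in> interior K" "v \<noteq> 0"
  shows "illuminated_from K p (v /\<^sub>R norm v)"
  unfolding illuminated_from_def
  using assms by (intro exI[of _ "t * norm v"]) (simp add: field_simps)

lemma proj_illuminable_imp_illuminate:
  fixes K :: "'a::euclidean_space set"
  assumes body: "convex_body K" and "proj_illuminable K k"
  obtains K' v where "combinatorially_equivalent K K'" "illuminate v k K'"
proof -
  have K: "compact K" "convex K" "interior K \<noteq> {}" using body by (auto simp: convex_body_def)
  obtain a c w s where pos: "\<And>x. x \<in> K \<Longrightarrow> 0 < a \<bullet> x + c"
    and ker: "\<And>i. i < k \<Longrightarrow> a \<bullet> w i + c * s i = 0"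
    and illum0: "\<And>p. p \<in> rel_frontier K \<Longrightarrow> \<exists>i<k. \<exists>t>0.
           t * s i < 1 \<and> p + t *\<^sub>R (w i - s i *\<^sub>R p) \<in> rel_interior K"
    using assms(2) unfolding proj_illuminable_def by blast
  have ri: "rel_interior K = interior K" using K(3) by (rule rel_interior_nonempty_interior)
  then have rf: "rel_frontier K = frontier K" by (simp add: rel_frontier_def frontier_def)
  note illum = illum0[unfolded ri rf]
  obtain x0 where x0: "x0 \<in> K" using K(3) interior_subset by blast
  define L where "L x = a \<bullet> x + c" for x
  have Lpos: "x \<in> K \<Longrightarrow> 0 < L x" for x using pos by (simp add: L_def)
  have L0: "0 < L x0" by (rule Lpos[OF x0])
  \<comment> \<open>The shift by \<open>x0\<close> keeps the chart injective: for
    \<open>c = 0\<close> the quotient \<open>x /\<^sub>R L x\<close> would be constant along rays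
    from the origin. The identity \<open>1 - a \<bullet> f x = L x0 / L x\<close> recovers
    \<open>L x\<close> from the image and yields the inverse \<open>g\<close>.\<close>
  define f where "f x = (x - x0) /\<^sub>R L x" for x
  define g where "g z = ((1 - a \<bullet> z) *\<^sub>R x0 + L x0 *\<^sub>R z) /\<^sub>R (1 - a \<bullet> z)" for z
  define D where "D = {x. 0 < L x}"
  define E where "E = {z. 0 < 1 - a \<bullet> z}"
  have KD: "K \<subseteq> D" using Lpos by (auto simp: D_def)
  have oD: "open D" "open E"
    unfolding D_def E_def L_def by (intro open_Collect_less continuous_intros)+
  have D_alt: "D = {x. a \<bullet> x > - c}" and E_alt: "E = {z. a \<bullet> z < 1}"
    by (auto simp: D_def E_def L_def)
  have cD: "convex D" "convex E"
    unfolding D_alt E_alt by (rule convex_halfspace_gt convex_halfspace_lt)+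
  have contf: "continuous_on D f"
    unfolding f_def L_def by (intro continuous_intros) (auto simp: D_def L_def)
  have contg: "continuous_on E g"
    unfolding g_def by (intro continuous_intros) (auto simp: E_def)
  have af: "1 - a \<bullet> f x = L x0 / L x" if "x \<in> D" for x
    using that by (simp add: f_def D_def inner_simps field_simps) (simp add: L_def)
  have fE: "f x \<in> E" if "x \<in> D" for x
  proof -
    have "0 < L x0 / L x" using that L0 by (simp add: D_def)
    then show ?thesis using af[OF that] by (simp add: E_def)
  qed
  have g_alt: "g z = x0 + (L x0 / (1 - a \<bullet> z)) *\<^sub>R z" if "z \<in> E" for z
    using that by (simp add: g_def E_def scaleR_right_distrib divide_inverse mult.commute)
  have gf: "g (f x) = x" if "x \<in> D" for x
  proof -
    have "g (f x) = x0 + (L x0 / (1 - a \<bullet> f x)) *\<^sub>R f x"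
      by (rule g_alt[OF fE[OF that]])
    also have "L x0 / (1 - a \<bullet> f x) = L x"
      using L0 by (simp add: af[OF that])
    also have "x0 + L x *\<^sub>R f x = x"
      using that by (simp add: f_def D_def)
    finally show ?thesis .
  qed
  have Lg: "L (g z) = L x0 / (1 - a \<bullet> z)" if "z \<in> E" for z
  proof -
    have "L (g z) = L x0 + L x0 / (1 - a \<bullet> z) * (a \<bullet> z)"
      by (simp add: g_alt[OF that] L_def inner_simps)
    also have "\<dots> = L x0 / (1 - a \<bullet> z)" using that by (simp add: E_def field_simps)
    finally show ?thesis .
  qed
  have gD: "g z \<in> D" if "z \<in> E" for z
    using Lg[OF that] that L0 by (simp add: D_def E_def)
  have fg: "f (g z) = z" if "z \<in> E" for z
  proof -
    have "g z - x0 = (L x0 / (1 - a \<bullet> z)) *\<^sub>R z"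
      by (simp add: g_alt[OF that])
    then show ?thesis using that L0 by (simp add: f_def Lg E_def)
  qed
  have fseg: "f z \<in> open_segment (f x) (f y)" if "x \<in> D" "y \<in> D" "z \<in> open_segment x y" for x y z
  proof -
    have "x \<noteq> y" using that by auto
    then have ne: "f x \<noteq> f y" using gf that by metis
    show ?thesis
      unfolding f_def
      by (rule fractional_map_open_segment)
        (use that ne in \<open>auto simp: f_def D_def L_def inner_simps algebra_simps\<close>)
  qed
  have gseg: "g z \<in> open_segment (g x) (g y)" if "x \<in> E" "y \<in> E" "z \<in> open_segment x y" for x y z
  proof -
    have "x \<noteq> y" using that by auto
    then have ne: "g x \<noteq> g y" using fg that by metis
    show ?thesis
      unfolding g_def
      by (rule fractional_map_open_segment)
        (use that ne in \<open>auto simp: g_def E_def inner_simps algebra_simps\<close>)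
  qed
  note equiv = combinatorially_equivalent_image[OF body KD oD(1) cD(1) oD(2) cD(2)
      contf fE gf contg gD fg fseg gseg]
  define v0 where "v0 i = w i - s i *\<^sub>R x0" for i
  obtain e :: 'a where e: "norm e = 1" using SOME_Basis norm_Basis by blast
  \<comment> \<open>The vector \<open>e\<close> is a default that keeps every \<open>v i\<close> a
    unit vector. It is never the illuminating direction, since \<open>v0 i = 0\<close> would put the
    image of a frontier point in the interior.\<close>
  define v where "v i = (if v0 i = 0 then e else v0 i /\<^sub>R norm (v0 i))" for i
  have illum': "\<exists>i<k. illuminated_from (f ` K) (f p) (v i)" if p: "p \<in> frontier K" for p
  proof -
    have pK: "p \<in> K" using p K by (simp add: frontier_def compact_imp_closed)
    obtain i t where it: "i < k" "t > 0" "t * s i < 1"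
      and z: "p + t *\<^sub>R (w i - s i *\<^sub>R p) \<in> interior K"
      using illum[OF p] by blast
    define z where "z = p + t *\<^sub>R (w i - s i *\<^sub>R p)"
    define m where "m = 1 - t * s i"
    have m: "0 < m" using it by (simp add: m_def)
    have aw: "a \<bullet> w i = - (c * s i)" using ker[OF it(1)] by linarith
    \<comment> \<open>The kernel condition makes \<open>L\<close> scale by
      \<open>m = 1 - t * s i\<close> along the path; \<open>t * s i < 1\<close> therefore keeps the
      path on the positive side and the factor of \<open>v0 i\<close> in \<open>fz\<close>
      positive.\<close>
    have Lz: "L z = L p * m"
      by (simp add: z_def L_def m_def inner_simps aw algebra_simps)
    have zx: "z - x0 = m *\<^sub>R (p - x0) + t *\<^sub>R v0 i"
      by (simp add: z_def m_def v0_def algebra_simps)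
    have fz: "f z = f p + (t / (L p * m)) *\<^sub>R v0 i"
    proof -
      have "inverse (L p * m) * m = inverse (L p)" "inverse (L p * m) * t = t / (L p * m)"
        using m Lpos[OF pK] by (simp_all add: field_simps)
      then show ?thesis by (simp only: f_def Lz zx scaleR_right_distrib scaleR_scaleR)
    qed
    have "f z \<in> f ` interior K" using z by (simp add: z_def)
    then have in_int: "f p + (t / (L p * m)) *\<^sub>R v0 i \<in> interior (f ` K)"
      using equiv(3) fz by simp
    have "v0 i \<noteq> 0"
    proof
      assume "v0 i = 0"
      then have "f p \<in> f ` interior K" using in_int equiv(3) by simp
      then obtain p' where "p' \<in> interior K" "f p = f p'" by blast
      moreover have "p' \<in> D" "p \<in> D" using calculation KD pK interior_subset by blast+
      ultimately have "p \<in> interior K" using gf by metis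
      then show False using p by (simp add: frontier_def)
    qed
    moreover have "0 < t / (L p * m)" using it m Lpos[OF pK] by simp
    ultimately have "illuminated_from (f ` K) (f p) (v i)"
      using illuminated_from_normalized[OF _ in_int] by (simp add: v_def)
    then show ?thesis using it by blast
  qed
  moreover have "v i \<in> sphere 0 1" for i using e by (simp add: v_def)
  ultimately have "illuminate v k (f ` K)"
    by (auto simp: illuminate_def equiv(2))
  then show thesis using that equiv(1) by blast
qed

section \<open>The lower bound\<close>

text \<open>If the vectors do not span, take a normal to a hyperplane containing them. If they span,
  there are too few of them to be dependent, so some linear form takes the value 1 on all of
  them.\<close>

lemma dual_vector_exists:
  fixes v :: "nat \<Rightarrow> 'a::euclidean_space"
  assumes "m \<le> DIM('a)"
  obtains u where "u \<noteq> 0" "\<And>i. i < m \<Longrightarrow> 0 \<le> u \<bullet> v i"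
proof (cases "span (v ` {..<m}) = UNIV")
  case False
  then obtain u where "u \<noteq> 0" "span (v ` {..<m}) \<subseteq> {x. u \<bullet> x = 0}"
    using span_not_univ_subset_hyperplane by blast
  then show thesis using that[of u] span_base by (smt (verit) imageI lessThan_iff mem_Collect_eq subsetD)
next
  case True
  let ?B = "v ` {..<m}"
  have "card ?B \<le> DIM('a)" using card_image_le[of "{..<m}" v] assms by simp
  then have "independent ?B"
    using True by (intro card_le_dim_spanning[of ?B UNIV]) auto
  then obtain l :: "'a \<Rightarrow> real" where l: "linear l" "\<And>x. x \<in> ?B \<Longrightarrow> l x = 1"
    using linear_independent_extend[of ?B "\<lambda>_. 1::real"] by auto
  define u where "u = adjoint l (1::real)"
  have adj: "u \<bullet> x = l x" for x
    using adjoint_works[OF l(1), of x 1] by (simp add: u_def inner_commute)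
  have "?B \<noteq> {}"
  proof
    assume "?B = {}"
    then have "(UNIV::'a set) = {0}" using True by simp
    then show False using UNIV_not_singleton by blast
  qed
  then obtain x where "x \<in> ?B" by blast
  then have "u \<noteq> 0" using adj[of x] l(2)[of x] by auto
  then show thesis using that[of u] adj l(2) by simp
qed

lemma illuminate_imp_gt_DIM:
  fixes K :: "'a::euclidean_space set"
  assumes "convex_body K" "illuminate v m K"
  shows "DIM('a) < m"
proof (rule ccontr)
  assume "\<not> DIM('a) < m"
  then obtain u where u: "u \<noteq> 0" "\<And>i. i < m \<Longrightarrow> 0 \<le> u \<bullet> v i"
    using dual_vector_exists[of m v] by auto
  have K: "compact K" "interior K \<noteq> {}" using assms by (auto simp: convex_body_def)
  then have "K \<noteq> {}" by auto
  moreover have "continuous_on K (\<lambda>x. u \<bullet> x)" by (intro continuous_intros)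
  ultimately obtain p where p: "p \<in> K" "\<And>x. x \<in> K \<Longrightarrow> u \<bullet> x \<le> u \<bullet> p"
    using continuous_attains_sup[OF K(1)] by blast
  \<comment> \<open>From an interior point one can move a little along \<open>u\<close> inside
    \<open>K\<close>, which increases the form; so the maximum is not attained there.\<close>
  have less: "u \<bullet> x < u \<bullet> p" if "x \<in> interior K" for x
  proof -
    obtain e where e: "e > 0" "cball x e \<subseteq> K" using \<open>x \<in> interior K\<close> mem_interior_cball by blast
    have "x + (e / norm u) *\<^sub>R u \<in> cball x e" using e u by (simp add: dist_norm)
    then have "u \<bullet> (x + (e / norm u) *\<^sub>R u) \<le> u \<bullet> p" using e p by blast
    moreover have "0 < (e / norm u) * (u \<bullet> u)" using e u by simp
    ultimately show ?thesis by (simp add: inner_simps)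
  qed
  have "p \<in> frontier K" using p(1) less K by (auto simp: frontier_def compact_imp_closed)
  then obtain i t where "i < m" "t \<ge> 0" "p + t *\<^sub>R v i \<in> interior K"
    using assms(2) unfolding illuminate_def illuminated_from_def by blast
  then have "u \<bullet> (p + t *\<^sub>R v i) < u \<bullet> p" "0 \<le> t * (u \<bullet> v i)" using less u(2) by auto
  then show False by (simp add: inner_simps)
qed

section \<open>Climbing up the flag\<close>

lemma combinatorial_illumination_number_eqI:
  fixes K :: "'a::euclidean_space set"
  assumes "convex_body K" "proj_illuminable K (DIM('a) + 1)"
  shows "combinatorial_illumination_number K = DIM('a) + 1"
  unfolding combinatorial_illumination_number_def
proof (rule Least_equality)
  show "\<exists>K' v. combinatorially_equivalent K K' \<and> illuminate v (DIM('a) + 1) K'"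
    using proj_illuminable_imp_illuminate[OF assms] by metis
next
  fix m assume "\<exists>K' v. combinatorially_equivalent K K' \<and> illuminate v m K'"
  then obtain K' :: "'a set" and v where "combinatorially_equivalent K K'" "illuminate v m K'"
    by blast
  then show "DIM('a) + 1 \<le> m"
    using illuminate_imp_gt_DIM[of K' v m] by (simp add: combinatorially_equivalent_def)
qed

text \<open>With an edge, the facet step is applied twice, from an end point of the edge to the edge
  and on to \<open>K\<close>, with counts 1, 2, 3. Without an edge, a relative boundary point inside
  a segment of \<open>K\<close> would have a one-dimensional supporting face, so \<open>K\<close> is
  strictly convex.\<close>

lemma proj_illuminable_plane:
  fixes K :: "'a::euclidean_space set"
  assumes K: "compact K" "convex K" "aff_dim K = 2"
  shows "proj_illuminable K 3"
proof (cases "\<exists>F. F face_of K \<and> aff_dim F = 1")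
  case True
  then obtain F where F: "F face_of K" "aff_dim F = 1" by blast
  have cF: "compact F" "convex F" "F \<noteq> {}"
    using K F face_of_imp_compact face_of_imp_convex by fastforce+
  obtain x where "x extreme_point_of F"
    using extreme_point_exists_convex[OF cF] by blast
  then have "proj_illuminable F (Suc 1)"
    using F(2) by (intro proj_illuminable_facet[OF cF(1,2), of "{x}"] proj_illuminable_sing)
      (simp_all add: face_of_singleton)
  then have "proj_illuminable K (Suc 2)"
    using K F cF(3) by (intro proj_illuminable_facet[OF K(1,2) F(1)]) (simp_all add: numeral_2_eq_2)
  then show ?thesis by (simp add: eval_nat_numeral)
next
  case False
  show ?thesis
  proof (intro proj_illuminable_strictly_convex_plane K subsetI)
    fix x y m assume xy: "x \<in> K" "y \<in> K" and m: "m \<in> open_segment x y"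
    show "m \<in> rel_interior K"
    proof (rule ccontr)
      assume out: "m \<notin> rel_interior K"
      have mK: "m \<in> K" using K(2) xy m convex_contains_open_segment by blast
      then obtain h where h: "(K \<inter> {z. h \<bullet> z = h \<bullet> m}) face_of K" "K \<inter> {z. h \<bullet> z = h \<bullet> m} \<noteq> K"
        using supporting_face[OF K(2) _ out] by metis
      let ?G = "K \<inter> {z. h \<bullet> z = h \<bullet> m}"
      have "{x, y} \<subseteq> ?G"
        using face_ofD[OF h(1) m] xy mK by blast
      then have "aff_dim {x, y} \<le> aff_dim ?G" by (rule aff_dim_subset)
      moreover have "x \<noteq> y" using m by auto
      moreover have "aff_dim ?G < 2" using face_of_aff_dim_lt[OF K(2) h] K(3) by simp
      ultimately have "aff_dim ?G = 1" by simp
      then show False using False h(1) by blast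
    qed
  qed
qed

text \<open>The planar case handles \<open>F 2\<close>. Each \<open>F i\<close> is a facet of
  \<open>F (Suc i)\<close>, and the last face of the flag is a facet of \<open>K\<close>, so every
  dimension costs one more direction.\<close>

lemma proj_illuminable_flag:
  fixes K :: "'a::euclidean_space set"
  assumes d: "DIM('a) > 2" and body: "convex_body K" and flag: "partial_flag K 2 F"
  shows "proj_illuminable K (DIM('a) + 1)"
proof -
  have K: "compact K" "convex K" "interior K \<noteq> {}" using body by (auto simp: convex_body_def)
  have F: "F i face_of K" "aff_dim (F i) = int i" if "2 \<le> i" "i < DIM('a)" for i
    using flag that by (auto simp: partial_flag_def)
  have mono: "F i \<subseteq> F (Suc i)" if "2 \<le> i" "Suc i < DIM('a)" for i
    using flag that by (auto simp: partial_flag_def)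
  have cF: "compact (F i)" "convex (F i)" "F i \<noteq> {}" if "2 \<le> i" "i < DIM('a)" for i
    using F[OF that] K face_of_imp_compact face_of_imp_convex by fastforce+
  have "2 \<le> i \<Longrightarrow> i < DIM('a) \<Longrightarrow> proj_illuminable (F i) (i + 1)" for i
  proof (induction i rule: dec_induct)
    case base
    then show ?case using proj_illuminable_plane[of "F 2"] F[of 2] cF[of 2] by simp
  next
    case (step i)
    then have i: "2 \<le> i" "i < DIM('a)" by auto
    have "F i face_of F (Suc i)"
      using F(1)[of i] F(1)[of "Suc i"] mono[of i] step i face_of_subset face_of_imp_subset
      by (metis le_SucI)
    then have "proj_illuminable (F (Suc i)) (Suc (i + 1))"
      using step i cF F(2)[of i] F(2)[of "Suc i"] by (intro proj_illuminable_facet[of _ "F i"]) auto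
    then show ?case by simp
  qed
  from this[of "DIM('a) - 1"] have "proj_illuminable (F (DIM('a) - 1)) DIM('a)" using d by simp
  moreover have "aff_dim K = int DIM('a)" using aff_dim_nonempty_interior[OF K(3)] .
  ultimately have "proj_illuminable K (Suc (DIM('a)))"
    using d F[of "DIM('a) - 1"] cF[of "DIM('a) - 1"]
    by (intro proj_illuminable_facet[OF K(1,2), of "F (DIM('a) - 1)"]) auto
  then show ?thesis by simp
qed

text \<open>Every polytope of positive dimension has a facet, again a polytope, so the induction can
  descend to a single point without assembling a flag.\<close>

lemma proj_illuminable_polytope:
  fixes P :: "'a::euclidean_space set"
  assumes "polytope P" "aff_dim P = int n"
  shows "proj_illuminable P (n + 1)"
  using assms
proof (induction n arbitrary: P)
  case 0
  then obtain x where "P = {x}" using aff_dim_eq_0[of P] by auto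
  then show ?case using proj_illuminable_sing by simp
next
  case (Suc n)
  obtain F where F: "F facet_of P"
    using polytope_facet_exists[OF Suc.prems(1)] Suc.prems(2) by auto
  then have face: "F face_of P" "F \<noteq> {}" "aff_dim F = int n"
    using Suc.prems(2) by (auto simp: facet_of_def)
  have "proj_illuminable F (n + 1)"
    using Suc.IH face face_of_polytope_polytope[OF Suc.prems(1)] by blast
  then have "proj_illuminable P (Suc (n + 1))"
    using Suc.prems face polytope_imp_compact polytope_imp_convex
    by (intro proj_illuminable_facet[of _ F]) auto
  then show ?case by simp
qed

theorem theorem2:
  assumes "DIM('a::euclidean_space) > 2"
  shows "(\<forall>K::'a set. convex_body K \<and> (\<exists>F. partial_flag K 2 F) \<longrightarrow>
            combinatorial_illumination_number K = DIM('a) + 1) \<and>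
         (\<forall>P::'a set. convex_polytope P \<longrightarrow>
            combinatorial_illumination_number P = DIM('a) + 1)"
proof (intro conjI allI impI)
  fix K :: "'a set"
  assume "convex_body K \<and> (\<exists>F. partial_flag K 2 F)"
  then show "combinatorial_illumination_number K = DIM('a) + 1"
    using assms proj_illuminable_flag combinatorial_illumination_number_eqI by blast
next
  fix P :: "'a set"
  assume "convex_polytope P"
  then have P: "convex_body P" "polytope P" by (auto simp: convex_polytope_def)
  then have "aff_dim P = int DIM('a)"
    by (auto simp: convex_body_def intro: aff_dim_nonempty_interior)
  with P show "combinatorial_illumination_number P = DIM('a) + 1"
    using proj_illuminable_polytope combinatorial_illumination_number_eqI by blast
qed

end
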